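(* Let $\rho_{AB}$ be a state on finite-dimensional systems $A,B$, let $n\ge1$, and let $A_1,\dots,A_n$ be copies of $A$. Then the optimal unilocal $n$-broadcasting fidelity $f_n(\rho_{AB})$ equals the optimal value of the semidefinite program \[ \begin{aligned} \max\ &\tfrac{1}{2}\mathrm{tr}(X_{AB}+X_{AB}^\dagger)\\ \text{s.t. }&\begin{pmatrix}\rho_{AB} & X_{AB}\\ X_{AB}^\dagger & \mathrm{tr}_{\backslash A_1B}(J^{T_A}\rho_{AB})\end{pmatrix}\ge0,\\ & J_{AA_1\cdots A_n}\ge0,\quad \mathrm{tr}_{A_1\cdots A_n}J_{AA_1\cdots A_n}=\mathbb{1}_A,\\ & J_{AA_1\cdots A_n}=\frac{1}{n!}\sum_{\pi\in S_n}W_\pi J_{AA_1\cdots A_n}W_\pi^\dagger, \end{aligned} \] where the variables are a linear operator $X_{AB}$ and a Hermitian operator $J_{AA_1\cdots A_n}$, $W_\pi$ acts on $A_1\cdots A_n$, and $\mathrm{tr}_{\backslash A_1B}(J^{T_A}\rho_{AB})$ denotes the operator on $A_1B$ obtained by forming $(J^{T_A}\otimes\mathbb{1}_B)(\rho_{AB}\otimes \mathbb{1}_{A_1\cdots A_n})$ and tracing out $A,A_2,\dots,A_n$ (with $A_1$ identified with $A$).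
   Context: Fidelity: $F(\rho,\sigma)=\mathrm{tr}\sqrt{\sqrt{\rho}\sigma\sqrt{\rho}}$. Systems $A_1,\dots,A_n$ are isomorphic to $A$, each with a fixed orthonormal basis $\{|j\rangle\}$. For a quantum channel $\Lambda_{A\to A_1\cdots A_n}$, $\mathrm{tr}_{\backslash A_jB}$ denotes tracing out all systems except $A_j$ and $B$. The optimal unilocal $n$-broadcasting fidelity of $\rho_{AB}$ on $A$ is \[f_n(\rho_{AB})=\sup\Big\{\frac1n\sum_{j=1}^nF\big(\rho_{AB},\mathrm{tr}_{\backslash A_jB}(\Lambda_{A\to A_1\cdots A_n}\otimes\mathrm{id}_B)(\rho_{AB})\big):\ \Lambda \text{ a quantum channel}\Big\},\] with $A_j$ identified with $A$. For a permutation $\pi\in S_n$, $W_\pi$ is the unitary on $A_1\cdots A_n$ with $W_\pi|j_1,\dots,j_n\rangle=|j_{\pi^{-1}(1)},\dots,j_{\pi^{-1}(n)}\rangle$. $T_A$ denotes partial transpose on $A$ in the fixed basis. (For a channel $\Lambda$ its Choi matrix is $J_\Lambda=(\mathrm{id}_{A}\otimes\Lambda)(\sum_{i,j}|ii\rangle\langle jj|)$, and $\Lambda(\rho_A)=\mathrm{tr}_A(J_\Lambda^{T_A}\rho_A)$.) *)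

theory Defs
  imports "Jordan_Normal_Form.Matrix" "HOL-Combinatorics.Permutations" Complex_Main
begin

text \<open>Conventions. Operators on a system of dimension d are complex d x d matrices
(Jordan_Normal_Form 'complex mat') in the fixed computational basis. Composite systems use the
Kronecker index convention: on X (dim dX) tensor Y (dim dY) the basis vector |x,y> has index
x * dY + y. The n copies A_1 ... A_n of A (dim dA) form a space of dimension dA^n, where the
basis vector |j_0,...,j_(n-1)> (position 0 = A_1, most significant digit) has index
sum_p j_p * dA^(n-1-p). Positions are 0-indexed: position p is the system A_(p+1).\<close>

definition mtrace :: "complex mat \<Rightarrow> complex" where
  "mtrace M = (\<Sum>i<dim_row M. M $$ (i, i))"

definition adj :: "complex mat \<Rightarrow> complex mat" where
  "adj M = mat (dim_col M) (dim_row M) (\<lambda>(i, j). cnj (M $$ (j, i)))"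

definition hermitian :: "complex mat \<Rightarrow> bool" where
  "hermitian M \<longleftrightarrow> square_mat M \<and> adj M = M"

definition psd :: "complex mat \<Rightarrow> bool" where
  "psd M \<longleftrightarrow> hermitian M \<and>
     (\<forall>v :: nat \<Rightarrow> complex. 0 \<le> Re (\<Sum>i<dim_row M. cnj (v i) * (\<Sum>j<dim_row M. M $$ (i, j) * v j)))"

definition density :: "nat \<Rightarrow> complex mat \<Rightarrow> bool" where
  "density d \<rho> \<longleftrightarrow> \<rho> \<in> carrier_mat d d \<and> psd \<rho> \<and> mtrace \<rho> = 1"

definition msqrt :: "complex mat \<Rightarrow> complex mat" where
  "msqrt M = (THE S. S \<in> carrier_mat (dim_row M) (dim_row M) \<and> psd S \<and> S * S = M)"

definition fidelity :: "complex mat \<Rightarrow> complex mat \<Rightarrow> real" where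
  "fidelity \<rho> \<sigma> = Re (mtrace (msqrt (msqrt \<rho> * \<sigma> * msqrt \<rho>)))"

definition kron :: "complex mat \<Rightarrow> complex mat \<Rightarrow> complex mat" where
  "kron M N = mat (dim_row M * dim_row N) (dim_col M * dim_col N)
     (\<lambda>(i, j). M $$ (i div dim_row N, j div dim_col N) * N $$ (i mod dim_row N, j mod dim_col N))"

definition chan_tensor_id ::
  "(complex mat \<Rightarrow> complex mat) \<Rightarrow> nat \<Rightarrow> nat \<Rightarrow> nat \<Rightarrow> complex mat \<Rightarrow> complex mat" where
  "chan_tensor_id \<Lambda> din dout k M =
     mat (dout * k) (dout * k)
       (\<lambda>(i, j). (\<Lambda> (mat din din (\<lambda>(a, a'). M $$ (a * k + i mod k, a' * k + j mod k))))
                  $$ (i div k, j div k))"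

definition quantum_channel :: "nat \<Rightarrow> nat \<Rightarrow> (complex mat \<Rightarrow> complex mat) \<Rightarrow> bool" where
  "quantum_channel din dout \<Lambda> \<longleftrightarrow>
     (\<forall>X \<in> carrier_mat din din. \<Lambda> X \<in> carrier_mat dout dout) \<and>
     (\<forall>X \<in> carrier_mat din din. \<forall>Y \<in> carrier_mat din din. \<forall>c :: complex.
        \<Lambda> (c \<cdot>\<^sub>m X + Y) = c \<cdot>\<^sub>m \<Lambda> X + \<Lambda> Y) \<and>
     (\<forall>X \<in> carrier_mat din din. mtrace (\<Lambda> X) = mtrace X) \<and>
     (\<forall>k. \<forall>M \<in> carrier_mat (din * k) (din * k). psd M \<longrightarrow> psd (chan_tensor_id \<Lambda> din dout k M))"

definition dig :: "nat \<Rightarrow> nat \<Rightarrow> nat \<Rightarrow> nat \<Rightarrow> nat" where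
  "dig d n i p = (i div d ^ (n - 1 - p)) mod d"

text \<open>tr of everything except A_(j+1) and B, for an operator on A_1...A_n B (dims dA^n, dB);
the result lives on A_(j+1) B, identified with A B (dim dA*dB).\<close>
definition marg :: "nat \<Rightarrow> nat \<Rightarrow> nat \<Rightarrow> nat \<Rightarrow> complex mat \<Rightarrow> complex mat" where
  "marg dA n dB j M = mat (dA * dB) (dA * dB) (\<lambda>(i, i').
     \<Sum>x<dA ^ n. \<Sum>x'<dA ^ n.
       if dig dA n x j = i div dB \<and> dig dA n x' j = i' div dB \<and>
          (\<forall>p<n. p \<noteq> j \<longrightarrow> dig dA n x p = dig dA n x' p)
       then M $$ (x * dB + i mod dB, x' * dB + i' mod dB) else 0)"

definition unilocal_fid :: "nat \<Rightarrow> nat \<Rightarrow> nat \<Rightarrow> complex mat \<Rightarrow> real" where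
  "unilocal_fid dA dB n \<rho> = Sup {v. \<exists>\<Lambda>. quantum_channel dA (dA ^ n) \<Lambda> \<and>
      v = (1 / real n) * (\<Sum>j<n. fidelity \<rho> (marg dA n dB j (chan_tensor_id \<Lambda> dA (dA ^ n) dB \<rho>)))}"

definition Wperm :: "nat \<Rightarrow> nat \<Rightarrow> (nat \<Rightarrow> nat) \<Rightarrow> complex mat" where
  "Wperm d n \<pi> = mat (d ^ n) (d ^ n)
     (\<lambda>(i, j). if (\<forall>p<n. dig d n i p = dig d n j (Hilbert_Choice.inv \<pi> p)) then 1 else 0)"

definition ptransA :: "nat \<Rightarrow> nat \<Rightarrow> complex mat \<Rightarrow> complex mat" where
  "ptransA dA m J = mat (dA * m) (dA * m)
     (\<lambda>(i, j). J $$ ((j div m) * m + i mod m, (i div m) * m + j mod m))"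

definition ptrace_first :: "nat \<Rightarrow> nat \<Rightarrow> complex mat \<Rightarrow> complex mat" where
  "ptrace_first d m M = mat m m (\<lambda>(i, j). \<Sum>a<d. M $$ (a * m + i, a * m + j))"

definition ptrace_second :: "nat \<Rightarrow> nat \<Rightarrow> complex mat \<Rightarrow> complex mat" where
  "ptrace_second d m M = mat d d (\<lambda>(i, j). \<Sum>x<m. M $$ (i * m + x, j * m + x))"

text \<open>rho_AB tensor 1 on A_1..A_n (dim N), arranged in the system order A A_1..A_n B.\<close>
definition embed_mid :: "nat \<Rightarrow> nat \<Rightarrow> nat \<Rightarrow> complex mat \<Rightarrow> complex mat" where
  "embed_mid dA N dB \<rho> = mat (dA * N * dB) (dA * N * dB) (\<lambda>(i, j).
     if (i div dB) mod N = (j div dB) mod N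
     then \<rho> $$ ((i div (N * dB)) * dB + i mod dB, (j div (N * dB)) * dB + j mod dB) else 0)"

definition reduced_op :: "nat \<Rightarrow> nat \<Rightarrow> nat \<Rightarrow> complex mat \<Rightarrow> complex mat \<Rightarrow> complex mat" where
  "reduced_op dA dB n J \<rho> =
     marg dA n dB 0 (ptrace_first dA (dA ^ n * dB)
       (kron (ptransA dA (dA ^ n) J) (1\<^sub>m dB) * embed_mid dA (dA ^ n) dB \<rho>))"

definition twirl :: "nat \<Rightarrow> nat \<Rightarrow> complex mat \<Rightarrow> complex mat" where
  "twirl dA n J = mat (dA * dA ^ n) (dA * dA ^ n) (\<lambda>(i, j).
     (1 / of_nat (fact n)) * (\<Sum>\<pi>\<in>{\<pi>. \<pi> permutes {..<n}}.
        (kron (1\<^sub>m dA) (Wperm dA n \<pi>) * J * adj (kron (1\<^sub>m dA) (Wperm dA n \<pi>))) $$ (i, j)))"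

definition sdp_feasible :: "nat \<Rightarrow> nat \<Rightarrow> nat \<Rightarrow> complex mat \<Rightarrow> complex mat \<Rightarrow> complex mat \<Rightarrow> bool" where
  "sdp_feasible dA dB n \<rho> X J \<longleftrightarrow>
     X \<in> carrier_mat (dA * dB) (dA * dB) \<and>
     J \<in> carrier_mat (dA * dA ^ n) (dA * dA ^ n) \<and> hermitian J \<and>
     psd (four_block_mat \<rho> X (adj X) (reduced_op dA dB n J \<rho>)) \<and>
     psd J \<and>
     ptrace_second dA (dA ^ n) J = 1\<^sub>m dA \<and>
     J = twirl dA n J"

definition sdp_value :: "nat \<Rightarrow> nat \<Rightarrow> nat \<Rightarrow> complex mat \<Rightarrow> real" where
  "sdp_value dA dB n \<rho> = Sup {v. \<exists>X J. sdp_feasible dA dB n \<rho> X J \<and>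
      v = (1 / 2) * Re (mtrace (X + adj X))}"

end

theory Submission
  imports Defs "Jordan_Normal_Form.Spectral_Radius"
begin

text \<open>
For positive \<open>P\<close>, \<open>Q\<close> the fidelity \<open>F(P, Q)\<close> is the maximum of \<open>Re (tr X)\<close> over all \<open>X\<close> for which the
block matrix \<open>(P, X; X\<^sup>*, Q)\<close> is positive; it is attained at \<open>X = S T\<^sup>+ S Q\<close> with \<open>S = \<surd>P\<close>,
\<open>T = \<surd>(S Q S)\<close>. Channels correspond to Choi matrices \<open>J\<close>, and averaging \<open>J\<close> over permutations of
the outputs replaces each marginal by the mean of all \<open>n\<close> marginals. Given a channel, twirling its
Choi matrix and averaging the optimal \<open>X\<close> of the \<open>n\<close> marginals gives a feasible point with the same
value. Conversely all \<open>n\<close> marginals of a permutation invariant \<open>J\<close> coincide, so the mean fidelity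
of its channel is at least \<open>Re (tr X)\<close> for every feasible \<open>X\<close>. The two sets of values dominate each
other, hence have the same supremum.
\<close>

section \<open>Spectral decomposition of Hermitian matrices\<close>

text \<open>Neither \<open>\<rho>\<close> nor its marginals need be invertible, hence the
  pseudo-inverses. For invertible \<open>S\<close> one has T^+ S Q = T S^-1, so the optimal X is S T
  S^-1, whose trace is visibly tr T; the form S T^+ S Q is the one that still makes sense for
  singular \<open>S\<close>. The averaging works because all the block matrices share the corner
  \<open>\<rho>\<close> and because the remaining blocks, the constraints on \<open>J\<close> and
  the objective behave linearly: an average of positive block matrices is again one, with the
  averaged X and the averaged marginal. The partial transpose in the semidefinite program only
  matches the Choi convention: multiplying by \<open>\<rho>\<close> and tracing out A is then the
  action of the channel with Choi matrix \<open>J\<close>, so both optimisation problems speak of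
  marginals of the same output. The fidelity is defined through \<open>msqrt\<close>, a definite
  description, which is why the spectral theorem and the uniqueness of positive roots come
  first.\<close>

lemma index_mult_mat_sum:
  assumes "A \<in> carrier_mat n m" "B \<in> carrier_mat m p" "i < n" "j < p"
  shows "(A * B) $$ (i, j) = (\<Sum>k<m. A $$ (i, k) * B $$ (k, j))"
  using assms by (auto simp: scalar_prod_def atLeast0LessThan)

lemma adj_dim [simp]: "dim_row (adj M) = dim_col M" "dim_col (adj M) = dim_row M"
  by (auto simp: adj_def)

lemma adj_index [simp]: "i < dim_col M \<Longrightarrow> j < dim_row M \<Longrightarrow> adj M $$ (i, j) = cnj (M $$ (j, i))"
  by (auto simp: adj_def)

lemma adj_carrier [simp]: "M \<in> carrier_mat n m \<Longrightarrow> adj M \<in> carrier_mat m n"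
  by auto

lemma adj_adj [simp]: "adj (adj M) = M"
  by (intro eq_matI) auto

lemma adj_one [simp]: "adj (1\<^sub>m n) = 1\<^sub>m n"
  by (intro eq_matI) auto

lemma adj_mult:
  assumes "A \<in> carrier_mat n m" "B \<in> carrier_mat m p"
  shows "adj (A * B) = adj B * adj A"
proof (rule eq_matI)
  fix i j assume "i < dim_row (adj B * adj A)" "j < dim_col (adj B * adj A)"
  then have i: "i < p" and j: "j < n" using assms by auto
  have "adj (A * B) $$ (i, j) = cnj ((A * B) $$ (j, i))" using assms i j by (intro adj_index) auto
  also have "\<dots> = (\<Sum>k<m. adj B $$ (i, k) * adj A $$ (k, j))"
    using assms i j by (subst index_mult_mat_sum[OF assms]) (auto simp: mult.commute)
  also have "\<dots> = (adj B * adj A) $$ (i, j)"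
    using assms i j by (subst index_mult_mat_sum[of _ p m _ n]) auto
  finally show "adj (A * B) $$ (i, j) = (adj B * adj A) $$ (i, j)" .
qed (use assms in auto)

lemma adj_minus:
  assumes "A \<in> carrier_mat n m" "B \<in> carrier_mat n m"
  shows "adj (A - B) = adj A - adj B"
  using assms by (intro eq_matI) auto

lemma adj_mat_diag: "adj (mat_diag n f) = mat_diag n (\<lambda>i. cnj (f i))"
  by (intro eq_matI) (auto simp: mat_diag_def)

lemma square_mult_carrier [simp]:
  "A \<in> carrier_mat n n \<Longrightarrow> B \<in> carrier_mat n n \<Longrightarrow> A * B \<in> carrier_mat n n"
  by (rule mult_carrier_mat)

lemma hermitian_congruence:
  assumes "M \<in> carrier_mat n n" "L \<in> carrier_mat n m" "adj M = M"
  shows "adj (adj L * M * L) = adj L * M * L"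
  using assms adj_mult[of "adj L * M" m n L m] adj_mult[of "adj L" m n M n]
  by (simp add: mult_carrier_mat[of _ m n _ n] assoc_mult_mat[of _ m n _ n _ m] del: assoc_mult_mat)

text \<open>The Householder reflection \<open>1 - 2 w w\<^sup>* / \<parallel>w\<parallel>\<^sup>2\<close> with \<open>w = v - e\<^sub>0\<close>. If \<open>w = 0\<close>, the
  convention \<open>2 / 0 = 0\<close> makes it the identity, as needed.\<close>
lemma householder_reflection:
  fixes v :: "nat \<Rightarrow> complex"
  assumes n: "0 < n" and norm: "(\<Sum>i<n. cnj (v i) * v i) = 1" and real: "cnj (v 0) = v 0"
  obtains H where "H \<in> carrier_mat n n" "adj H = H" "H * H = 1\<^sub>m n" "\<And>i. i < n \<Longrightarrow> H $$ (i, 0) = v i"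
proof -
  define w where "w i = v i - (if i = 0 then 1 else 0)" for i
  define c where "c = 2 / (\<Sum>i<n. cnj (w i) * w i)"
  define H where "H = mat n n (\<lambda>(i, j). (if i = j then 1 else 0) - c * (w i * cnj (w j)))"
  have w2: "(\<Sum>i<n. cnj (w i) * w i) = 2 - 2 * v 0"
  proof -
    have "(\<Sum>i<n. cnj (w i) * w i) =
        (\<Sum>i<n. cnj (v i) * v i - (if i = 0 then v 0 + cnj (v 0) - 1 else 0))"
      by (intro sum.cong) (auto simp: w_def algebra_simps)
    also have "\<dots> = 2 - 2 * v 0" using n norm real by (simp add: sum_subtractf sum.delta)
    finally show ?thesis .
  qed
  \<comment> \<open>Reality of \<open>v 0\<close> makes the normalising constant real, and
    \<open>H\<close> Hermitian.\<close>
  have cc: "cnj c = c" using real by (simp add: c_def w2)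
  have cw: "c * c * (\<Sum>i<n. cnj (w i) * w i) = 2 * c"
    by (cases "(\<Sum>i<n. cnj (w i) * w i) = 0") (auto simp: c_def)
  have H: "H \<in> carrier_mat n n" by (simp add: H_def)
  have hh: "H * H = 1\<^sub>m n"
  proof (rule eq_matI)
    fix i j assume "i < dim_row (1\<^sub>m n :: complex mat)" "j < dim_col (1\<^sub>m n :: complex mat)"
    then have ij: "i < n" "j < n" by auto
    have "(H * H) $$ (i, j) = (\<Sum>k<n. H $$ (i, k) * H $$ (k, j))"
      by (rule index_mult_mat_sum[OF H H ij])
    also have "\<dots> = (\<Sum>k<n. (if i = k then (if k = j then 1 else 0) else 0)
        - (if i = k then c * (w k * cnj (w j)) else 0) - (if k = j then c * (w i * cnj (w k)) else 0)
        + c * c * (w i * cnj (w j)) * (cnj (w k) * w k))"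
      using ij by (intro sum.cong) (auto simp: H_def algebra_simps)
    also have "\<dots> = (if i = j then 1 else 0) - 2 * c * (w i * cnj (w j))
        + (c * c * (\<Sum>k<n. cnj (w k) * w k)) * (w i * cnj (w j))"
      using ij by (simp add: sum.distrib sum_subtractf sum_distrib_left sum_distrib_right algebra_simps)
    also have "\<dots> = (1\<^sub>m n) $$ (i, j)" using ij by (simp add: cw)
    finally show "(H * H) $$ (i, j) = (1\<^sub>m n) $$ (i, j)" .
  qed (use H in auto)
  have "H $$ (i, 0) = v i" if i: "i < n" for i
  proof (cases "(\<Sum>i<n. cnj (w i) * w i) = 0")
    case True
    have "(\<Sum>i<n. cnj (w i) * w i) = of_real (\<Sum>i<n. (cmod (w i))\<^sup>2)"
      by (simp add: mult.commute complex_norm_square[symmetric])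
    with True have "(\<Sum>i<n. (cmod (w i))\<^sup>2) = 0" by (metis of_real_eq_0_iff)
    then have "w i = 0" using i by (subst (asm) sum_nonneg_eq_0_iff) auto
    then show ?thesis using i n by (auto simp: H_def w_def split: if_splits)
  next
    case False
    \<comment> \<open>Thus \<open>c * cnj (w 0)\<close> is -1 and column 0 of \<open>H\<close> is
      e_0 + w, which is \<open>v\<close>.\<close>
    then have "c * (v 0 - 1) = -1" unfolding c_def w2 by (simp add: field_simps)
    moreover have "cnj (w 0) = v 0 - 1" using real by (simp add: w_def)
    ultimately have "c * (w i * cnj (w 0)) = - w i" by (metis (no_types) mult.left_commute mult.right_neutral mult_minus_right)
    then show ?thesis using i n by (simp add: H_def) (simp add: w_def)
  qed
  moreover have "adj H = H" by (rule eq_matI) (auto simp: H_def cc mult.commute)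
  ultimately show thesis using that H hh by blast
qed

lemma unit_eigenvector:
  assumes M: "(M :: complex mat) \<in> carrier_mat n n" and n: "0 < n"
  obtains v :: "nat \<Rightarrow> complex" and k where "(\<Sum>i<n. cnj (v i) * v i) = 1" "cnj (v 0) = v 0"
    "\<And>i. i < n \<Longrightarrow> (\<Sum>j<n. M $$ (i, j) * v j) = k * v i"
proof -
  from spectrum_non_empty[OF M n] obtain k x where "eigenvector M x k"
    unfolding spectrum_def eigenvalue_def by auto
  then have x: "x \<in> carrier_vec n" "x \<noteq> 0\<^sub>v n" "M *\<^sub>v x = k \<cdot>\<^sub>v x"
    using M by (auto simp: eigenvector_def)
  define r where "r = (\<Sum>i<n. (cmod (x $ i))\<^sup>2)"
  \<comment> \<open>The phase \<open>u\<close> turns component 0 of the eigenvector into its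
    modulus, because \<open>householder_reflection\<close> asks for a real
    \<open>v 0\<close>.\<close>
  define u where "u = (if x $ 0 = 0 then 1 else cnj (sgn (x $ 0)))"
  define v where "v i = u * x $ i / of_real (sqrt r)" for i
  have "r > 0"
  proof -
    obtain i where "i < n" "x $ i \<noteq> 0" using x by (metis carrier_vecD eq_vecI index_zero_vec)
    then have "(cmod (x $ i))\<^sup>2 \<le> r" "(cmod (x $ i))\<^sup>2 > 0" unfolding r_def
      by (auto intro!: member_le_sum)
    then show ?thesis by linarith
  qed
  then have r: "sqrt r * sqrt r = r" "sqrt r \<noteq> 0" by auto
  have sgn: "cnj (sgn z) * z = of_real (cmod z)" for z :: complex
  proof (cases "z = 0")
    case False
    have "cnj (sgn z) * z = (z * cnj z) / of_real (cmod z)" by (simp add: sgn_eq)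
    also have "\<dots> = of_real (cmod z)" using False by (simp add: complex_norm_square[symmetric] power2_eq_square)
    finally show ?thesis .
  qed simp
  have u: "cnj u * u = 1"
  proof (cases "x $ 0 = 0")
    case False
    then have "sgn (x $ 0) * cnj (sgn (x $ 0)) = 1"
      by (simp add: complex_norm_square[symmetric] norm_sgn)
    then show ?thesis using False by (simp add: u_def)
  qed (simp add: u_def)
  have "(\<Sum>i<n. cnj (v i) * v i) = (\<Sum>i<n. of_real ((cmod (x $ i))\<^sup>2)) / of_real r"
  proof (subst sum_divide_distrib, rule sum.cong[OF refl])
    fix i
    have "cnj (v i) * v i = (cnj u * u) * (cnj (x $ i) * x $ i) / of_real (sqrt r * sqrt r)"
      by (simp only: v_def complex_cnj_mult complex_cnj_divide complex_cnj_complex_of_real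
          of_real_mult times_divide_times_eq mult_ac)
    also have "\<dots> = of_real ((cmod (x $ i))\<^sup>2) / of_real r"
      unfolding u r(1) by (simp add: mult.commute complex_norm_square[symmetric])
    finally show "cnj (v i) * v i = of_real ((cmod (x $ i))\<^sup>2) / of_real r" .
  qed
  also have "\<dots> = 1" using \<open>r > 0\<close> by (simp add: r_def del: of_real_power flip: of_real_sum)
  finally have 1: "(\<Sum>i<n. cnj (v i) * v i) = 1" .
  have "u * x $ 0 = of_real (cmod (x $ 0))"
    by (simp add: u_def sgn)
  then have 2: "cnj (v 0) = v 0" unfolding v_def by simp
  have 3: "(\<Sum>j<n. M $$ (i, j) * v j) = k * v i" if i: "i < n" for i
  proof -
    have "(M *\<^sub>v x) $ i = (\<Sum>j<n. M $$ (i, j) * x $ j)"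
      using i M x(1) by (auto simp: scalar_prod_def atLeast0LessThan)
    then have "(\<Sum>j<n. M $$ (i, j) * x $ j) = k * x $ i" using x i by simp
    then have "(\<Sum>j<n. M $$ (i, j) * x $ j) * (u / of_real (sqrt r)) = k * v i"
      by (simp add: v_def)
    then show ?thesis by (simp add: v_def sum_distrib_right sum_distrib_left mult_ac sum_divide_distrib)
  qed
  show thesis using that[OF 1 2 3] by blast
qed

definition unitary :: "nat \<Rightarrow> complex mat \<Rightarrow> bool" where
  "unitary n U \<longleftrightarrow> U \<in> carrier_mat n n \<and> adj U * U = 1\<^sub>m n \<and> U * adj U = 1\<^sub>m n"

text \<open>For a fixed unitary this is a functional calculus in \<open>f\<close>: roots,
  pseudo-inverses and the relations between them reduce to pointwise identities of scalars. Only the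
  values of \<open>f\<close> below \<open>n\<close> matter.\<close>

definition spectral :: "nat \<Rightarrow> complex mat \<Rightarrow> (nat \<Rightarrow> complex) \<Rightarrow> complex mat" where
  "spectral n U f = U * mat_diag n f * adj U"

lemma spectral_carrier [simp]: "U \<in> carrier_mat n n \<Longrightarrow> spectral n U f \<in> carrier_mat n n"
  by (auto simp: spectral_def)

lemma spectral_mult:
  assumes "unitary n U"
  shows "spectral n U f * spectral n U g = spectral n U (\<lambda>i. f i * g i)"
proof -
  have U: "U \<in> carrier_mat n n" and 1: "adj U * U = 1\<^sub>m n" using assms by (auto simp: unitary_def)
  have "spectral n U f * spectral n U g = U * mat_diag n f * (adj U * U) * mat_diag n g * adj U"
    using U by (simp add: spectral_def assoc_mult_mat[of _ n n _ n _ n] del: assoc_mult_mat)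
  also have "\<dots> = U * (mat_diag n f * mat_diag n g) * adj U"
    unfolding 1 using U by (simp add: left_mult_one_mat[of _ n n] assoc_mult_mat[of _ n n _ n _ n] del: assoc_mult_mat mat_diag_diag)
  finally show ?thesis by (simp add: spectral_def)
qed

lemma adj_spectral:
  assumes "U \<in> carrier_mat n n"
  shows "adj (spectral n U f) = spectral n U (\<lambda>i. cnj (f i))"
  using assms by (simp add: spectral_def adj_mult[of _ n n _ n] adj_mat_diag assoc_mult_mat[of _ n n _ n _ n] del: assoc_mult_mat)

text \<open>Deflation: conjugation by a reflection whose column 0 is a unit eigenvector clears
  column 0 outside the diagonal, and the induction hypothesis diagonalises the remaining
  block.\<close>

lemma hermitian_spectral:
  assumes "M \<in> carrier_mat n n" "adj M = M"
  shows "\<exists>U f. unitary n U \<and> M = spectral n U f"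
  using assms
proof (induction n arbitrary: M)
  case 0
  have "unitary 0 (1\<^sub>m 0)" "M = spectral 0 (1\<^sub>m 0) (\<lambda>_. 0)"
    using 0 by (auto simp: unitary_def spectral_def intro!: eq_matI)
  then show ?case by blast
next
  case (Suc m)
  let ?n = "Suc m"
  note M = Suc.prems(1)
  obtain v k where v: "(\<Sum>i<?n. cnj (v i) * v i) = 1" "cnj (v 0) = v 0"
    "\<And>i. i < ?n \<Longrightarrow> (\<Sum>j<?n. M $$ (i, j) * v j) = k * v i"
    using unit_eigenvector[OF M] by blast
  obtain H where H: "H \<in> carrier_mat ?n ?n" "adj H = H" "H * H = 1\<^sub>m ?n" "\<And>i. i < ?n \<Longrightarrow> H $$ (i, 0) = v i"
    using householder_reflection[OF _ v(1,2)] by blast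
  define N where "N = H * M * H"
  have N: "N \<in> carrier_mat ?n ?n" using H M by (auto simp: N_def)
  have Nh: "adj N = N" using hermitian_congruence[OF M H(1) Suc.prems(2)] by (simp add: H(2) N_def)
  have N0: "N $$ (i, 0) = (if i = 0 then k else 0)" if i: "i < ?n" for i
  proof -
    have "N = H * (M * H)" using H M by (simp add: N_def assoc_mult_mat[of _ ?n ?n _ ?n _ ?n] del: assoc_mult_mat)
    then have "N $$ (i, 0) = (\<Sum>j<?n. H $$ (i, j) * (M * H) $$ (j, 0))"
      using index_mult_mat_sum[OF H(1) mult_carrier_mat[OF M H(1)], of i 0] i by simp
    also have "\<dots> = (\<Sum>j<?n. H $$ (i, j) * (k * H $$ (j, 0)))"
    proof (rule sum.cong[OF refl])
      fix j assume "j \<in> {..<?n}"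
      then have j: "j < ?n" by simp
      have "(M * H) $$ (j, 0) = (\<Sum>l<?n. M $$ (j, l) * v l)"
        using index_mult_mat_sum[OF M H(1) j, of 0] H(4) by simp
      then show "H $$ (i, j) * (M * H) $$ (j, 0) = H $$ (i, j) * (k * H $$ (j, 0))"
        using v(3)[OF j] H(4)[OF j] by simp
    qed
    also have "\<dots> = k * (H * H) $$ (i, 0)"
      by (subst index_mult_mat_sum[OF H(1) H(1) i]) (auto simp: sum_distrib_left mult_ac simp del: sum.lessThan_Suc)
    finally show ?thesis using i by (simp add: H(3))
  qed
  \<comment> \<open>Hermiticity carries the zeros of column 0 over to row 0, so \<open>N\<close>
    splits into the scalar \<open>k\<close> and the block \<open>N'\<close>.\<close>
  have N0': "N $$ (0, i) = (if i = 0 then k else 0)" if i: "i < ?n" for i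
  proof -
    have "N $$ (0, i) = cnj (N $$ (i, 0))" using Nh N i adj_index[of 0 N i] by auto
    then show ?thesis using N0[OF i] N0[of 0] Nh N adj_index[of 0 N 0] by (auto split: if_splits)
  qed
  define N' where "N' = mat m m (\<lambda>(i, j). N $$ (Suc i, Suc j))"
  have "adj N' = N'"
  proof (rule eq_matI)
    fix i j assume "i < dim_row N'" "j < dim_col N'"
    then have "i < m" "j < m" by (auto simp: N'_def)
    then show "adj N' $$ (i, j) = N' $$ (i, j)"
      using adj_index[of "Suc i" N "Suc j"] N Nh by (auto simp: N'_def)
  qed (auto simp: N'_def)
  then obtain V f where V: "unitary m V" and N'eq: "N' = spectral m V f"
    using Suc.IH[of N'] by (auto simp: N'_def)
  have Vc: "V \<in> carrier_mat m m" using V by (simp add: unitary_def)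
  define W where "W = four_block_mat (1\<^sub>m 1) (0\<^sub>m 1 m) (0\<^sub>m m 1) V"
  define g where "g i = (case i of 0 \<Rightarrow> k | Suc j \<Rightarrow> f j)" for i
  have Wc: "W \<in> carrier_mat ?n ?n" using Vc by (auto simp: W_def)
  have aW: "adj W = four_block_mat (1\<^sub>m 1) (0\<^sub>m 1 m) (0\<^sub>m m 1) (adj V)"
    using Vc by (intro eq_matI) (auto simp: W_def)
  have one: "four_block_mat (1\<^sub>m 1) (0\<^sub>m 1 m) (0\<^sub>m m 1) (1\<^sub>m m) = (1\<^sub>m ?n :: complex mat)"
    by (intro eq_matI) auto
  have blk: "four_block_mat A (0\<^sub>m 1 m) (0\<^sub>m m 1) D * four_block_mat A' (0\<^sub>m 1 m) (0\<^sub>m m 1) D'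
      = four_block_mat (A * A') (0\<^sub>m 1 m) (0\<^sub>m m 1) (D * D')"
    if "A \<in> carrier_mat 1 1" "A' \<in> carrier_mat 1 1" "D \<in> carrier_mat m m" "D' \<in> carrier_mat m m"
    for A A' D D' :: "complex mat"
    using that by (subst mult_four_block_mat[of _ 1 1 _ m _ m _ _ 1 _ m]) auto
  have W: "unitary ?n W"
    using V Wc unfolding unitary_def aW by (simp add: W_def blk one plus_1_eq_Suc del: One_nat_def)
  have dg: "mat_diag ?n g = four_block_mat (mat_diag 1 (\<lambda>_. k)) (0\<^sub>m 1 m) (0\<^sub>m m 1) (mat_diag m f)"
    by (intro eq_matI) (auto simp: mat_diag_def g_def split: nat.split)
  have "spectral ?n W g = four_block_mat (mat_diag 1 (\<lambda>_. k)) (0\<^sub>m 1 m) (0\<^sub>m m 1) N'"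
    using Vc unfolding spectral_def aW dg N'eq by (simp add: W_def blk left_mult_one_mat[of _ 1 1] right_mult_one_mat[of _ 1 1] del: One_nat_def)
  also have "\<dots> = N"
  proof (rule eq_matI)
    fix i j assume "i < dim_row N" "j < dim_col N"
    then have "i < ?n" "j < ?n" using N by auto
    then show "four_block_mat (mat_diag 1 (\<lambda>_. k)) (0\<^sub>m 1 m) (0\<^sub>m m 1) N' $$ (i, j) = N $$ (i, j)"
      using N0[of i] N0'[of j] by (auto simp: N'_def mat_diag_def)
  qed (use N in \<open>auto simp: N'_def mat_diag_def\<close>)
  finally have Nsp: "N = spectral ?n W g" by simp
  have "H * N * H = (H * H) * M * (H * H)"
    using H(1) M by (simp add: N_def assoc_mult_mat[of _ ?n ?n _ ?n _ ?n] del: assoc_mult_mat)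
  then have "M = H * N * H" using H(3) M by simp
  also have "\<dots> = spectral ?n (H * W) g"
    using H(1,2) Wc by (simp add: Nsp spectral_def adj_mult[of _ ?n ?n _ ?n] assoc_mult_mat[of _ ?n ?n _ ?n _ ?n] del: assoc_mult_mat)
  finally have "M = spectral ?n (H * W) g" .
  moreover have "unitary ?n (H * W)"
  proof -
    have "adj (H * W) * (H * W) = adj W * (H * H) * W"
      using H(1,2) Wc by (simp add: adj_mult[of _ ?n ?n _ ?n] assoc_mult_mat[of _ ?n ?n _ ?n _ ?n] del: assoc_mult_mat)
    moreover have "(H * W) * adj (H * W) = H * (W * adj W) * H"
      using H(1,2) Wc by (simp add: adj_mult[of _ ?n ?n _ ?n] assoc_mult_mat[of _ ?n ?n _ ?n _ ?n] del: assoc_mult_mat)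
    ultimately show ?thesis using W H(1,3) Wc by (simp add: unitary_def)
  qed
  ultimately show ?case by blast
qed

section \<open>Positive semidefinite matrices\<close>

text \<open>Vectors are functions on the naturals, as in the quantifier of \<open>psd\<close>. The
  two arguments are kept apart so that matrix entries and the contributions of off-diagonal blocks
  are values of the form too.\<close>

definition sform :: "nat \<Rightarrow> complex mat \<Rightarrow> (nat \<Rightarrow> complex) \<Rightarrow> (nat \<Rightarrow> complex) \<Rightarrow> complex" where
  "sform n M u v = (\<Sum>i<n. \<Sum>j<n. cnj (u i) * M $$ (i, j) * v j)"

lemma sform_sum_left:
  "sform n M (\<lambda>k. \<Sum>i\<in>I. a i * u i k) w = (\<Sum>i\<in>I. cnj (a i) * sform n M (u i) w)"
proof -
  have "sform n M (\<lambda>k. \<Sum>i\<in>I. a i * u i k) w =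
      (\<Sum>k<n. \<Sum>l<n. \<Sum>i\<in>I. cnj (a i) * (cnj (u i k) * M $$ (k, l) * w l))"
    by (simp add: sform_def sum_distrib_left sum_distrib_right mult_ac)
  also have "\<dots> = (\<Sum>k<n. \<Sum>i\<in>I. \<Sum>l<n. cnj (a i) * (cnj (u i k) * M $$ (k, l) * w l))"
    by (intro sum.cong refl sum.swap)
  also have "\<dots> = (\<Sum>i\<in>I. \<Sum>k<n. \<Sum>l<n. cnj (a i) * (cnj (u i k) * M $$ (k, l) * w l))"
    by (rule sum.swap)
  finally show ?thesis by (simp add: sform_def sum_distrib_left)
qed

lemma sform_sum_right:
  "sform n M w (\<lambda>k. \<Sum>i\<in>I. a i * u i k) = (\<Sum>i\<in>I. a i * sform n M w (u i))"
proof -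
  have "sform n M w (\<lambda>k. \<Sum>i\<in>I. a i * u i k) =
      (\<Sum>k<n. \<Sum>l<n. \<Sum>i\<in>I. a i * (cnj (w k) * M $$ (k, l) * u i l))"
    by (simp add: sform_def sum_distrib_left sum_distrib_right mult_ac)
  also have "\<dots> = (\<Sum>k<n. \<Sum>i\<in>I. \<Sum>l<n. a i * (cnj (w k) * M $$ (k, l) * u i l))"
    by (intro sum.cong refl sum.swap)
  also have "\<dots> = (\<Sum>i\<in>I. \<Sum>k<n. \<Sum>l<n. a i * (cnj (w k) * M $$ (k, l) * u i l))"
    by (rule sum.swap)
  finally show ?thesis by (simp add: sform_def sum_distrib_left)
qed

lemma psd_iff:
  assumes "M \<in> carrier_mat n n"
  shows "psd M \<longleftrightarrow> adj M = M \<and> (\<forall>v. 0 \<le> Re (sform n M v v))"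
  using assms by (auto simp: psd_def hermitian_def sform_def sum_distrib_left mult.assoc)

text \<open>The link between products and forms: congruences, reindexings, partial traces and the
  Cauchy-Schwarz bounds are all read off from the columns of the outer factors.\<close>

lemma sandwich_index:
  assumes "X \<in> carrier_mat n n" "A \<in> carrier_mat n m" "B \<in> carrier_mat n p" "i < m" "j < p"
  shows "(adj A * X * B) $$ (i, j) = sform n X (\<lambda>k. A $$ (k, i)) (\<lambda>k. B $$ (k, j))"
proof -
  have e: "(adj A * X) $$ (i, l) = (\<Sum>k<n. adj A $$ (i, k) * X $$ (k, l))" if "l < n" for l
    using index_mult_mat_sum[of "adj A" m n X n i l] assms that by simp
  have "(adj A * X * B) $$ (i, j) = (\<Sum>l<n. \<Sum>k<n. adj A $$ (i, k) * X $$ (k, l) * B $$ (l, j))"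
    using index_mult_mat_sum[of "adj A * X" m n B p i j] assms
    by (simp add: mult_carrier_mat[of _ m n _ n] e sum_distrib_right del: index_mult_mat(1))
  also have "\<dots> = (\<Sum>k<n. \<Sum>l<n. adj A $$ (i, k) * X $$ (k, l) * B $$ (l, j))" by (rule sum.swap)
  finally show ?thesis using assms by (simp add: sform_def)
qed

text \<open>The form of \<open>adj L * M * L\<close> at \<open>v\<close> is the form of
  \<open>M\<close> at \<open>L\<close> applied to \<open>v\<close>, which is \<open>?w\<close>
  below.\<close>

lemma psd_congruence:
  assumes M: "M \<in> carrier_mat n n" "psd M" and L: "L \<in> carrier_mat n m"
  shows "psd (adj L * M * L)"
proof -
  have c: "adj L * M * L \<in> carrier_mat m m" using M L by (auto intro!: mult_carrier_mat)
  have h: "adj M = M" using M by (simp add: psd_iff)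
  show ?thesis unfolding psd_iff[OF c]
  proof (intro conjI allI)
    fix v
    let ?w = "\<lambda>k. \<Sum>i<m. v i * L $$ (k, i)"
    have "sform m (adj L * M * L) v v =
        (\<Sum>i<m. cnj (v i) * (\<Sum>j<m. v j * sform n M (\<lambda>k. L $$ (k, i)) (\<lambda>k. L $$ (k, j))))"
      unfolding sform_def[of m] sum_distrib_left
      by (intro sum.cong refl) (simp add: sandwich_index[OF M(1) L L])
    also have "\<dots> = sform n M ?w ?w"
      unfolding sform_sum_left by (simp add: sform_sum_right)
    finally show "0 \<le> Re (sform m (adj L * M * L) v v)"
      using M psd_iff[OF M(1)] by simp
  qed (rule hermitian_congruence[OF M(1) L h])
qed

lemma psd_one: "psd (1\<^sub>m n)"
proof -
  have "Re (sform n (1\<^sub>m n) v v) = (\<Sum>i<n. (cmod (v i))\<^sup>2)" for v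
  proof -
    have "sform n (1\<^sub>m n) v v = (\<Sum>i<n. \<Sum>j<n. if i = j then cnj (v i) * v i else 0)"
      unfolding sform_def by (intro sum.cong) auto
    also have "\<dots> = (\<Sum>i<n. of_real ((cmod (v i))\<^sup>2))"
      by (simp add: mult.commute complex_norm_square[symmetric])
    finally show ?thesis by simp
  qed
  then show ?thesis by (subst psd_iff[of _ n]) (auto intro!: sum_nonneg)
qed

lemma psd_adj_mult_self:
  assumes "L \<in> carrier_mat n m"
  shows "psd (adj L * L)"
  using psd_congruence[OF one_carrier_mat psd_one assms] assms
  by (simp add: right_mult_one_mat[of _ m n])

lemma sform_delta:
  "i < n \<Longrightarrow> j < n \<Longrightarrow> sform n M (\<lambda>k. if k = i then 1 else 0) (\<lambda>k. if k = j then 1 else 0) = M $$ (i, j)"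
proof -
  assume ij: "i < n" "j < n"
  have "sform n M (\<lambda>k. if k = i then 1 else 0) (\<lambda>k. if k = j then 1 else 0) =
      (\<Sum>k<n. \<Sum>l<n. if k = i then (if l = j then M $$ (i, j) else 0) else 0)"
    unfolding sform_def by (intro sum.cong) auto
  also have "\<dots> = (\<Sum>k<n. if k = i then M $$ (i, j) else 0)" using ij by (intro sum.cong) auto
  finally show ?thesis using ij by simp
qed

lemma psd_diag:
  assumes "M \<in> carrier_mat n n" "psd M" "i < n"
  shows "0 \<le> Re (M $$ (i, i))" "M $$ (i, i) = of_real (Re (M $$ (i, i)))"
proof -
  show "0 \<le> Re (M $$ (i, i))"
    using sform_delta[OF assms(3,3), of M] assms psd_iff by metis
  have "cnj (M $$ (i, i)) = M $$ (i, i)" using assms psd_iff[OF assms(1)] adj_index[of i M i] by auto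
  then show "M $$ (i, i) = of_real (Re (M $$ (i, i)))" by (simp add: complex_eq_iff)
qed

lemma spectral_sandwich:
  assumes "unitary n U"
  shows "adj U * spectral n U f * U = mat_diag n f"
proof -
  have U: "U \<in> carrier_mat n n" and 1: "adj U * U = 1\<^sub>m n" using assms by (auto simp: unitary_def)
  have "adj U * spectral n U f * U = (adj U * U) * mat_diag n f * (adj U * U)"
    using U by (simp add: spectral_def assoc_mult_mat[of _ n n _ n _ n] del: assoc_mult_mat)
  then show ?thesis unfolding 1 by (simp add: left_mult_one_mat[of _ n n] right_mult_one_mat[of _ n n])
qed

lemma psd_spectralI:
  assumes U: "unitary n U" and t: "\<And>i. 0 \<le> t i"
  shows "psd (spectral n U (\<lambda>i. of_real (t i)))"
proof -
  have c: "U \<in> carrier_mat n n" using U by (simp add: unitary_def)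
  define S where "S = spectral n U (\<lambda>i. of_real (sqrt (t i)))"
  have "adj S = S" using c by (simp add: S_def adj_spectral)
  then have "adj S * S = spectral n U (\<lambda>i. of_real (t i))"
    using t by (simp add: S_def spectral_mult[OF U] flip: of_real_mult)
  then show ?thesis using psd_adj_mult_self[of S n n] c by (simp add: S_def)
qed

lemma psd_spectral:
  assumes M: "M \<in> carrier_mat n n" "psd M"
  obtains U t where "unitary n U" "\<And>i. 0 \<le> t i" "M = spectral n U (\<lambda>i. of_real (t i))"
proof -
  obtain U f where U: "unitary n U" and f: "M = spectral n U f"
    using hermitian_spectral[OF M(1)] M by (auto simp: psd_iff)
  have c: "U \<in> carrier_mat n n" using U by (simp add: unitary_def)
  have "psd (mat_diag n f)" using psd_congruence[OF M c] spectral_sandwich[OF U] f by simp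
  then have fi: "0 \<le> Re (f i)" "f i = of_real (Re (f i))" if "i < n" for i
    using psd_diag[of "mat_diag n f" n i] that by (auto simp: mat_diag_def)
  \<comment> \<open>The values of \<open>f\<close> from \<open>n\<close> on are arbitrary; setting
    them to 0 makes \<open>t\<close> nonnegative everywhere.\<close>
  define t where "t i = (if i < n then Re (f i) else 0)" for i
  have "mat_diag n f = mat_diag n (\<lambda>i. of_real (t i))"
    using fi(2) by (intro eq_matI) (auto simp: mat_diag_def t_def)
  then have "M = spectral n U (\<lambda>i. of_real (t i))" by (simp add: f spectral_def)
  moreover have "0 \<le> t i" for i using fi(1) by (simp add: t_def)
  ultimately show thesis using that U by blast
qed

section \<open>Square roots and pseudo-inverses of positive matrices\<close>

lemma psd_square_root_exists:
  assumes "M \<in> carrier_mat n n" "psd M"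
  obtains S where "S \<in> carrier_mat n n" "psd S" "S * S = M"
proof -
  obtain U t where U: "unitary n U" and t: "\<And>i. 0 \<le> t i" "M = spectral n U (\<lambda>i. of_real (t i))"
    using psd_spectral[OF assms] by blast
  have c: "U \<in> carrier_mat n n" using U by (simp add: unitary_def)
  define S where "S = spectral n U (\<lambda>i. of_real (sqrt (t i)))"
  have "S * S = M" using t by (simp add: S_def spectral_mult[OF U] flip: of_real_mult)
  moreover have "psd S" unfolding S_def by (rule psd_spectralI[OF U]) (simp add: t)
  ultimately show thesis using that[of S] c by (simp add: S_def)
qed

lemma mtrace_mult_comm:
  assumes "A \<in> carrier_mat n m" "B \<in> carrier_mat m n"
  shows "mtrace (A * B) = mtrace (B * A)"
proof -
  have "mtrace (A * B) = (\<Sum>i<n. \<Sum>k<m. A $$ (i, k) * B $$ (k, i))"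
    using assms by (simp add: mtrace_def index_mult_mat_sum[of _ n m _ n] del: index_mult_mat(1))
  also have "\<dots> = (\<Sum>k<m. \<Sum>i<n. B $$ (k, i) * A $$ (i, k))"
    by (subst sum.swap) (simp add: mult.commute)
  also have "\<dots> = mtrace (B * A)"
    using assms by (simp add: mtrace_def index_mult_mat_sum[of _ m n _ m] del: index_mult_mat(1))
  finally show ?thesis .
qed

lemma mtrace_add:
  assumes "A \<in> carrier_mat n n" "B \<in> carrier_mat n n"
  shows "mtrace (A + B) = mtrace A + mtrace B"
  using assms by (simp add: mtrace_def sum.distrib)

lemma mtrace_adj_mult_self:
  assumes "A \<in> carrier_mat n m"
  shows "mtrace (adj A * A) = of_real (\<Sum>j<m. \<Sum>i<n. (cmod (A $$ (i, j)))\<^sup>2)"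
  using assms
  by (simp add: mtrace_def index_mult_mat_sum[of _ m n _ m] mult.commute complex_norm_square[symmetric]
      del: index_mult_mat(1))

lemma mtrace_adj_mult_self_eq_0:
  assumes A: "A \<in> carrier_mat n m" and 0: "Re (mtrace (adj A * A)) \<le> 0"
  shows "A = 0\<^sub>m n m"
proof -
  have "(\<Sum>j<m. \<Sum>i<n. (cmod (A $$ (i, j)))\<^sup>2) \<le> 0"
    using 0 by (simp add: mtrace_adj_mult_self[OF A])
  then have "(\<Sum>j<m. \<Sum>i<n. (cmod (A $$ (i, j)))\<^sup>2) = 0"
    by (intro antisym sum_nonneg) auto
  then have "\<forall>j<m. \<forall>i<n. A $$ (i, j) = 0"
    by (subst (asm) sum_nonneg_eq_0_iff) (auto simp: sum_nonneg_eq_0_iff intro!: sum_nonneg)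
  then show ?thesis using A by (intro eq_matI) auto
qed

text \<open>With \<open>D = S - R\<close> one has \<open>S D + D R = 0\<close>, hence \<open>tr (D S D) + tr (D R D) = 0\<close>; both traces
  are nonnegative, so \<open>S D = R D = 0\<close> and \<open>D\<^sup>2 = 0\<close>.\<close>
lemma psd_square_root_unique:
  assumes S: "S \<in> carrier_mat n n" "psd S" and R: "R \<in> carrier_mat n n" "psd R" and eq: "S * S = R * R"
  shows "S = R"
proof -
  define D where "D = S - R"
  have D: "D \<in> carrier_mat n n" using S R by (auto simp: D_def)
  have aD: "adj D = D" using S R adj_minus[of S n n R] by (simp add: D_def psd_iff)
  \<comment> \<open>With roots \<open>P\<close> of \<open>S\<close> and \<open>Q\<close> of
    \<open>R\<close>, the traces of D S D and D R D become squared Frobenius norms of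
    \<open>P * D\<close> and \<open>Q * D\<close>.\<close>
  obtain P where P: "P \<in> carrier_mat n n" "psd P" "P * P = S" by (rule psd_square_root_exists[OF S])
  obtain Q where Q: "Q \<in> carrier_mat n n" "psd Q" "Q * Q = R" by (rule psd_square_root_exists[OF R])
  have aPQ: "adj P = P" "adj Q = Q" using P Q by (auto simp: psd_iff)
  note assoc = assoc_mult_mat[of _ n n _ n _ n]
  have tr: "mtrace (adj (P * D) * (P * D)) = mtrace (D * (S * D))"
    unfolding P(3)[symmetric] using P(1) D by (simp add: adj_mult[of _ n n _ n] aPQ aD assoc del: assoc_mult_mat)
  have "mtrace (adj (Q * D) * (Q * D)) = mtrace (D * (R * D))"
    unfolding Q(3)[symmetric] using Q(1) D by (simp add: adj_mult[of _ n n _ n] aPQ aD assoc del: assoc_mult_mat)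
  also have "\<dots> = mtrace (D * (D * R))"
    using mtrace_mult_comm[of "D * R" n n D] D R by (simp add: assoc del: assoc_mult_mat)
  finally have "mtrace (adj (P * D) * (P * D)) + mtrace (adj (Q * D) * (Q * D)) = mtrace (D * (S * D) + D * (D * R))"
    using tr D S R mtrace_add[of "D * (S * D)" n "D * (D * R)"] by simp
  also have "D * (S * D) + D * (D * R) = D * (S * D + D * R)"
    using D S R by (simp add: mult_add_distrib_mat[of _ n n _ n])
  also have "S * D + D * R = 0\<^sub>m n n"
  proof -
    have "S * D + D * R = (S * S - S * R) + (S * R - R * R)"
      using S R by (simp add: D_def mult_minus_distrib_mat[of _ n n _ n] minus_mult_distrib_mat[of _ n n _ _ n])
    also have "\<dots> = 0\<^sub>m n n" unfolding eq using S R by (intro eq_matI) (auto simp del: index_mult_mat(1))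
    finally show ?thesis .
  qed
  finally have 0: "mtrace (adj (P * D) * (P * D)) + mtrace (adj (Q * D) * (Q * D)) = 0"
    using D by (simp add: mtrace_def)
  have nn: "0 \<le> Re (mtrace (adj (P * D) * (P * D)))" "0 \<le> Re (mtrace (adj (Q * D) * (Q * D)))"
    using P Q D by (auto simp: mtrace_adj_mult_self[of _ n n] intro!: sum_nonneg)
  then have "P * D = 0\<^sub>m n n" "Q * D = 0\<^sub>m n n"
    using arg_cong[OF 0, of Re] P Q D by (auto intro!: mtrace_adj_mult_self_eq_0)
  moreover have "S * D = P * (P * D)" "R * D = Q * (Q * D)"
    unfolding P(3)[symmetric] Q(3)[symmetric] using P Q D by (auto simp: assoc)
  ultimately have "S * D = 0\<^sub>m n n" "R * D = 0\<^sub>m n n" using P Q by auto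
  then have "adj D * D = 0\<^sub>m n n"
    unfolding aD using S R minus_mult_distrib_mat[of S n n R D n] D by (simp add: D_def[symmetric])
  then have "D = 0\<^sub>m n n" using mtrace_adj_mult_self_eq_0[OF D] by (simp add: mtrace_def)
  then have "D + R = R" using R by simp
  moreover have "D + R = S" using S R by (intro eq_matI) (auto simp: D_def)
  ultimately show ?thesis by simp
qed

lemma msqrt:
  assumes "M \<in> carrier_mat n n" "psd M"
  shows "msqrt M \<in> carrier_mat n n" "psd (msqrt M)" "msqrt M * msqrt M = M"
proof -
  obtain S where "S \<in> carrier_mat n n" "psd S" "S * S = M" by (rule psd_square_root_exists[OF assms])
  then have "\<exists>!S. S \<in> carrier_mat n n \<and> psd S \<and> S * S = M"
    using psd_square_root_unique[of _ n] by metis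
  from theI'[OF this] show "msqrt M \<in> carrier_mat n n" "psd (msqrt M)" "msqrt M * msqrt M = M"
    using assms(1) unfolding msqrt_def by auto
qed

text \<open>The convention \<open>inverse 0 = 0\<close> makes inversion of the eigenvalues the
  Moore-Penrose inverse; each relation is then one of the scalar identities
  \<open>e\<close>.\<close>

lemma psd_pseudo_inverse:
  assumes "S \<in> carrier_mat n n" "psd S"
  obtains P where "P \<in> carrier_mat n n" "adj P = P" "P * S = S * P" "P * (S * S) = S" "P * (P * S) = P"
proof -
  obtain U t where U: "unitary n U" and t: "S = spectral n U (\<lambda>i. of_real (t i))"
    using psd_spectral[OF assms] by blast
  have c: "U \<in> carrier_mat n n" using U by (simp add: unitary_def)
  define P where "P = spectral n U (\<lambda>i. inverse (of_real (t i)))"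
  have e: "inverse x * x = x * inverse x" "inverse x * (x * x) = x" "inverse x * (x * inverse x) = inverse x" for x :: complex
    by (cases "x = 0"; simp)+
  have "P * S = S * P" "P * (S * S) = S" "P * (P * S) = P"
    unfolding P_def t spectral_mult[OF U] e by (rule refl)+
  moreover have "adj P = P" unfolding P_def adj_spectral[OF c] by simp
  ultimately show thesis using that[of P] c by (simp add: P_def)
qed

section \<open>Fidelity as an optimum over positive block matrices\<close>

lemma sum_add_lessThan: "(\<Sum>i<m + n. f i) = (\<Sum>i<m. f i) + (\<Sum>i<n. f (m + i))" for f :: "nat \<Rightarrow> 'a::comm_monoid_add"
  by (induction n) (auto simp: add.assoc)

lemma sform_four_block:
  assumes "A \<in> carrier_mat n n" "B \<in> carrier_mat n n" "C \<in> carrier_mat n n" "D \<in> carrier_mat n n"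
  shows "sform (n + n) (four_block_mat A B C D) v v =
    sform n A v v + sform n B v (\<lambda>i. v (n + i)) +
    sform n C (\<lambda>i. v (n + i)) v + sform n D (\<lambda>i. v (n + i)) (\<lambda>i. v (n + i))"
proof -
  let ?F = "four_block_mat A B C D"
  have r: "(\<Sum>j<n + n. cnj (v i) * ?F $$ (i, j) * v j) =
      (\<Sum>j<n. cnj (v i) * A $$ (i, j) * v j) + (\<Sum>j<n. cnj (v i) * B $$ (i, j) * v (n + j))" if "i < n" for i
    using assms that unfolding sum_add_lessThan by (intro arg_cong2[of _ _ _ _ "(+)"] sum.cong) auto
  have s: "(\<Sum>j<n + n. cnj (v (n + i)) * ?F $$ (n + i, j) * v j) =
      (\<Sum>j<n. cnj (v (n + i)) * C $$ (i, j) * v j) + (\<Sum>j<n. cnj (v (n + i)) * D $$ (i, j) * v (n + j))" if "i < n" for i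
    using assms that unfolding sum_add_lessThan by (intro arg_cong2[of _ _ _ _ "(+)"] sum.cong) auto
  have "sform (n + n) ?F v v = (\<Sum>i<n. \<Sum>j<n + n. cnj (v i) * ?F $$ (i, j) * v j)
      + (\<Sum>i<n. \<Sum>j<n + n. cnj (v (n + i)) * ?F $$ (n + i, j) * v j)"
    unfolding sform_def by (rule sum_add_lessThan)
  then show ?thesis by (simp add: r s sform_def sum.distrib)
qed

lemma adj_four_block:
  assumes "A \<in> carrier_mat n n" "B \<in> carrier_mat n n" "C \<in> carrier_mat n n" "D \<in> carrier_mat n n"
  shows "adj (four_block_mat A B C D) = four_block_mat (adj A) (adj C) (adj B) (adj D)"
  using assms by (intro eq_matI) auto

lemma psd_add:
  assumes "A \<in> carrier_mat n n" "B \<in> carrier_mat n n" "psd A" "psd B"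
  shows "psd (A + B)"
proof -
  have c: "A + B \<in> carrier_mat n n" using assms by simp
  have "adj (A + B) = adj A + adj B" using assms by (intro eq_matI) auto
  moreover have "sform n (A + B) v v = sform n A v v + sform n B v v" for v
    using assms by (simp add: sform_def algebra_simps sum.distrib)
  ultimately show ?thesis using assms unfolding psd_iff[OF c] by (auto simp: psd_iff[of _ n])
qed

lemma psd_four_block_zero:
  assumes R: "R \<in> carrier_mat n n" "psd R"
  shows "psd (four_block_mat (0\<^sub>m n n) (0\<^sub>m n n) (0\<^sub>m n n) R)"
proof -
  have c: "four_block_mat (0\<^sub>m n n) (0\<^sub>m n n) (0\<^sub>m n n) R \<in> carrier_mat (n + n) (n + n)" using R by simp
  have "adj (0\<^sub>m n n) = (0\<^sub>m n n)" by (intro eq_matI) auto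
  moreover have "sform n (0\<^sub>m n n) u v = 0" for u v by (simp add: sform_def)
  ultimately show ?thesis using R unfolding psd_iff[OF c]
    by (simp add: sform_four_block[of _ n] adj_four_block[of _ n] psd_iff[of _ n])
qed

text \<open>The matrix is \<open>adj ?L * ?L\<close>, where \<open>?L\<close> has rows (S, K) and
  (0, 0), plus the Schur complement in the lower corner. Giving the off-diagonal block as
  \<open>S * K\<close> covers singular \<open>S\<close>.\<close>

lemma psd_schur_complement:
  assumes S: "S \<in> carrier_mat n n" "adj S = S" and K: "K \<in> carrier_mat n n" and Q: "Q \<in> carrier_mat n n"
    and psd: "psd (Q - adj K * K)"
  shows "psd (four_block_mat (S * S) (S * K) (adj (S * K)) Q)"
proof -
  let ?Z = "0\<^sub>m n n"
  let ?L = "four_block_mat S K ?Z ?Z"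
  have Z: "adj ?Z = (?Z :: complex mat)" by (intro eq_matI) auto
  have "adj ?L * ?L = four_block_mat (S * S) (S * K) (adj (S * K)) (adj K * K)"
    using S K by (simp add: adj_four_block[of _ n] Z adj_mult[of _ n n _ n] mult_four_block_mat[of _ n n _ n _ n _ _ n _ n]
        right_add_zero_mat[of _ n n])
  then have "four_block_mat (S * S) (S * K) (adj (S * K)) Q =
      adj ?L * ?L + four_block_mat ?Z ?Z ?Z (Q - adj K * K)"
    using S K Q by (intro eq_matI) (auto simp del: index_mult_mat(1))
  moreover have "psd (adj ?L * ?L)" using S K by (intro psd_adj_mult_self[of _ "n + n" "n + n"]) auto
  moreover have "psd (four_block_mat ?Z ?Z ?Z (Q - adj K * K))" using psd K Q by (intro psd_four_block_zero) auto
  ultimately show ?thesis using S K Q by (auto intro!: psd_add[of _ "n + n"])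
qed

text \<open>The block form at the vector with halves \<open>s u\<close> and
  \<open>- t cnj z w\<close> is a nonnegative real quadratic in \<open>s\<close> and
  \<open>t\<close>; the bound is its discriminant condition.\<close>

lemma four_block_cauchy_schwarz:
  assumes c: "P \<in> carrier_mat n n" "X \<in> carrier_mat n n" "Q \<in> carrier_mat n n"
    and psd: "psd (four_block_mat P X (adj X) Q)" "psd Q"
  shows "(cmod (sform n X u w))\<^sup>2 \<le> Re (sform n P u u) * Re (sform n Q w w)"
proof -
  define p q z where "p = Re (sform n P u u)" and "q = Re (sform n Q w w)" and "z = sform n X u w"
  have F: "four_block_mat P X (adj X) Q \<in> carrier_mat (n + n) (n + n)" using c by simp
  have z': "sform n (adj X) w u = cnj z"
    unfolding z_def sform_def cnj_sum using c by (subst sum.swap) (auto intro!: sum.cong simp: mult_ac)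
  have quad: "0 \<le> s * s * p + t * t * (cmod z)\<^sup>2 * q - 2 * (s * t * (cmod z)\<^sup>2)" for s t :: real
  proof -
    \<comment> \<open>The factor \<open>cnj z\<close> aligns the phases, so that both cross terms
      equal - s t |z|^2.\<close>
    define d where "d = - (of_real t * cnj z)"
    define v where "v i = (if i < n then of_real s * u i else d * w (i - n))" for i
    have "sform n P v v = sform n P (\<lambda>i. of_real s * u i) (\<lambda>i. of_real s * u i)"
      "sform n X v (\<lambda>i. v (n + i)) = sform n X (\<lambda>i. of_real s * u i) (\<lambda>i. d * w i)"
      "sform n (adj X) (\<lambda>i. v (n + i)) v = sform n (adj X) (\<lambda>i. d * w i) (\<lambda>i. of_real s * u i)"
      "sform n Q (\<lambda>i. v (n + i)) (\<lambda>i. v (n + i)) = sform n Q (\<lambda>i. d * w i) (\<lambda>i. d * w i)"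
      unfolding sform_def v_def by (auto intro!: sum.cong)
    moreover have sc: "sform n M (\<lambda>i. a * f i) (\<lambda>i. b * g i) = cnj a * b * sform n M f g" for M a b f g
      by (simp add: sform_def sum_distrib_left mult_ac)
    ultimately have "sform (n + n) (four_block_mat P X (adj X) Q) v v =
        of_real (s * s) * sform n P u u + of_real s * (d * z) + of_real s * (cnj d * cnj z) + (cnj d * d) * sform n Q w w"
      using c by (simp add: sform_four_block[of _ n] z' mult_ac flip: z_def)
    moreover have "d * z = - of_real (t * (cmod z)\<^sup>2)" "cnj d * cnj z = - of_real (t * (cmod z)\<^sup>2)"
      "cnj d * d = of_real (t * t * (cmod z)\<^sup>2)"
      unfolding d_def by (simp_all add: complex_norm_square[symmetric] mult_ac)
    ultimately have "sform (n + n) (four_block_mat P X (adj X) Q) v v =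
        of_real (s * s) * sform n P u u - of_real (2 * (s * t * (cmod z)\<^sup>2)) + of_real (t * t * (cmod z)\<^sup>2) * sform n Q w w"
      by (simp only:) (simp add: algebra_simps)
    moreover have "0 \<le> Re (sform (n + n) (four_block_mat P X (adj X) Q) v v)"
      using psd(1) psd_iff[OF F] by blast
    ultimately show ?thesis by (simp add: p_def q_def)
  qed
  have q: "q \<ge> 0" using psd(2) psd_iff[OF c(3)] by (simp add: q_def)
  have "(cmod z)\<^sup>2 \<le> p * q"
  proof (cases "q = 0")
    case True
    have "z = 0"
    proof (rule ccontr)
      assume "z \<noteq> 0"
      \<comment> \<open>For \<open>q = 0\<close> this \<open>t\<close> gives the quadratic the value
        p - (p + 1) = -1.\<close>
      then show False using quad[of 1 "(p + 1) / (2 * (cmod z)\<^sup>2)"] True by simp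
    qed
    then show ?thesis using True by simp
  next
    case False
    \<comment> \<open>At \<open>s = 1\<close> the minimum lies at t = 1/q; scaling both by
      \<open>q\<close> avoids the fraction.\<close>
    have "0 \<le> q * (q * p - (cmod z)\<^sup>2)" using quad[of q 1] by (simp add: algebra_simps)
    then show ?thesis using False q by (simp add: zero_le_mult_iff mult.commute)
  qed
  then show ?thesis by (simp add: p_def q_def z_def)
qed

lemma four_block_cauchy_schwarz_entries:
  assumes c: "P \<in> carrier_mat n n" "X \<in> carrier_mat n n" "Q \<in> carrier_mat n n"
    and psd: "psd (four_block_mat P X (adj X) Q)" "psd Q"
    and AB: "A \<in> carrier_mat n n" "B \<in> carrier_mat n n" and ij: "i < n" "j < n"
  shows "(cmod ((adj A * X * B) $$ (i, j)))\<^sup>2 \<le>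
    Re ((adj A * P * A) $$ (i, i)) * Re ((adj B * Q * B) $$ (j, j))"
  using four_block_cauchy_schwarz[OF c psd] ij
  by (simp add: sandwich_index[OF c(2) AB] sandwich_index[OF c(1) AB(1) AB(1)] sandwich_index[OF c(3) AB(2) AB(2)]
      del: index_mult_mat(1))

lemma mtrace_spectral:
  assumes "unitary n U"
  shows "mtrace (spectral n U f) = (\<Sum>i<n. f i)"
proof -
  have U: "U \<in> carrier_mat n n" and 1: "adj U * U = 1\<^sub>m n" using assms by (auto simp: unitary_def)
  have "mtrace (spectral n U f) = mtrace (mat_diag n f * (adj U * U))"
    using U mtrace_mult_comm[of U n n "mat_diag n f * adj U"]
    by (simp add: spectral_def assoc_mult_mat[of _ n n _ n _ n] del: assoc_mult_mat)
  then show ?thesis by (simp add: 1 right_mult_one_mat[of _ n n] mtrace_def mat_diag_def)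
qed

text \<open>Let \<open>R\<close> be the pseudo-inverse of \<open>T\<close> and X = S K with K = R S
  Q. The Schur complement is Q - K^* K = Q - Q W Q with W = S R R S. The point is that W Q W = W:
  the Hermitian \<open>W\<close> is a generalized inverse, which makes Q - Q W Q the congruence of
  \<open>Q\<close> by 1 - W Q, hence positive.\<close>

lemma fidelity_attained:
  assumes P: "P \<in> carrier_mat n n" "psd P" and Q: "Q \<in> carrier_mat n n" "psd Q"
  obtains X where "X \<in> carrier_mat n n" "psd (four_block_mat P X (adj X) Q)" "Re (mtrace X) = fidelity P Q"
proof -
  define S where "S = msqrt P"
  have S: "S \<in> carrier_mat n n" "psd S" "S * S = P" using msqrt[OF P] by (auto simp: S_def)
  have aS: "adj S = S" and aQ: "adj Q = Q" using S Q by (auto simp: psd_iff)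
  have SQS: "S * Q * S \<in> carrier_mat n n" "psd (S * Q * S)"
    using psd_congruence[OF Q S(1)] S Q by (auto simp: aS)
  define T where "T = msqrt (S * Q * S)"
  have T: "T \<in> carrier_mat n n" "psd T" "T * T = S * Q * S" using msqrt[OF SQS] by (auto simp: T_def)
  obtain R where R: "R \<in> carrier_mat n n" "adj R = R" "R * T = T * R" "R * (T * T) = T" "R * (R * T) = R"
    using psd_pseudo_inverse[OF T(1,2)] by blast
  note assoc = assoc_mult_mat[of _ n n _ n _ n]
  define K where "K = R * S * Q"
  define W where "W = S * R * R * S"
  have K: "K \<in> carrier_mat n n" using R S Q by (simp add: K_def)
  have W: "W \<in> carrier_mat n n" "adj W = W" using R S
    by (simp_all add: W_def adj_mult[of _ n n _ n] aS assoc del: assoc_mult_mat)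
  have KK: "adj K * K = Q * W * Q" using R S Q
    by (simp add: K_def W_def adj_mult[of _ n n _ n] aS aQ assoc del: assoc_mult_mat)
  have "W * Q * W = S * R * R * (S * Q * S) * R * R * S"
    using R S Q by (simp add: W_def assoc del: assoc_mult_mat)
  also have "\<dots> = S * R * (R * (T * T)) * R * R * S"
    using R S Q T(1) by (simp add: T(3)[symmetric] assoc del: assoc_mult_mat)
  also have "\<dots> = S * (R * (T * R)) * R * S"
    unfolding R(4) using R(1) S T(1) by (simp add: assoc del: assoc_mult_mat)
  also have "R * (T * R) = R" using R(3,5) by simp
  finally have WQW: "W * Q * W = W" by (simp add: W_def)
  then have WQW: "W * (Q * W) = W" using W Q by (simp add: assoc del: assoc_mult_mat)
  have "adj (1\<^sub>m n - W * Q) * Q * (1\<^sub>m n - W * Q) = (Q - Q * W * Q) * (1\<^sub>m n - W * Q)"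
    using W Q by (simp add: adj_minus[of _ n n] adj_mult[of _ n n _ n] aQ minus_mult_distrib_mat[of _ n n _ _ n])
  also have "\<dots> = (Q - Q * W * Q) - (Q * W * Q - Q * (W * (Q * W)) * Q)"
    using W Q by (simp add: mult_minus_distrib_mat[of _ n n _ n] minus_mult_distrib_mat[of _ n n _ _ n] right_mult_one_mat[of _ n n]
      minus_carrier_mat assoc del: assoc_mult_mat)
  also have "\<dots> = Q - adj K * K"
    unfolding WQW KK using W Q by (intro eq_matI) (auto simp del: index_mult_mat(1))
  finally have "psd (Q - adj K * K)"
    using psd_congruence[OF Q, of "1\<^sub>m n - W * Q" n] W Q by (simp add: minus_carrier_mat)
  from psd_schur_complement[OF S(1) aS K Q(1) this]
  have 1: "psd (four_block_mat P (S * K) (adj (S * K)) Q)" by (simp add: S(3))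
  \<comment> \<open>Cyclicity puts the two factors \<open>S\<close> on either side of
    \<open>Q\<close>, which produces \<open>R * (T * T) = T\<close>.\<close>
  have "mtrace (S * K) = mtrace (R * (S * Q * S))"
    using mtrace_mult_comm[OF S(1) K] R S Q by (simp add: K_def assoc del: assoc_mult_mat)
  also have "\<dots> = mtrace T" by (simp add: T(3)[symmetric] R(4))
  finally have "Re (mtrace (S * K)) = fidelity P Q"
    by (simp add: fidelity_def T_def S_def)
  then show thesis using that[of "S * K"] 1 S K by simp
qed

text \<open>With \<open>S = \<surd>P\<close>, \<open>S\<^sup>+\<close> its pseudo-inverse and \<open>T = \<surd>(S Q S) = U diag(t) U\<^sup>*\<close>, positivity of the
  block matrix forces \<open>X = S S\<^sup>+ X\<close>, so \<open>tr X\<close> is the trace of \<open>(S\<^sup>+ U)\<^sup>* X (S U)\<close>, whose \<open>i\<close>-th diagonal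
  entry is at most \<open>t i\<close> in modulus by Cauchy--Schwarz.\<close>
lemma fidelity_upper_bound:
  assumes P: "P \<in> carrier_mat n n" "psd P" and Q: "Q \<in> carrier_mat n n" "psd Q"
    and X: "X \<in> carrier_mat n n" and psd: "psd (four_block_mat P X (adj X) Q)"
  shows "Re (mtrace X) \<le> fidelity P Q"
proof -
  define S where "S = msqrt P"
  have S: "S \<in> carrier_mat n n" "psd S" "S * S = P" using msqrt[OF P] by (auto simp: S_def)
  have aS: "adj S = S" using S by (auto simp: psd_iff)
  have SQS: "S * Q * S \<in> carrier_mat n n" "psd (S * Q * S)"
    using psd_congruence[OF Q S(1)] S Q by (auto simp: aS)
  define T where "T = msqrt (S * Q * S)"
  have T: "T \<in> carrier_mat n n" "psd T" "T * T = S * Q * S" using msqrt[OF SQS] by (auto simp: T_def)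
  obtain U t where U: "unitary n U" and t: "\<And>i. 0 \<le> t i" "T = spectral n U (\<lambda>i. of_real (t i))"
    using psd_spectral[OF T(1,2)] by blast
  have Uc: "U \<in> carrier_mat n n" "adj U * U = 1\<^sub>m n" "U * adj U = 1\<^sub>m n" using U by (auto simp: unitary_def)
  obtain R where R: "R \<in> carrier_mat n n" "adj R = R" "R * S = S * R" "R * (S * S) = S" "R * (R * S) = R"
    using psd_pseudo_inverse[OF S(1,2)] by blast
  note assoc = assoc_mult_mat[of _ n n _ n _ n]
  \<comment> \<open>\<open>S * R\<close> projects onto the range of \<open>S\<close>, and
    \<open>Z\<close> is the complementary projection. Since \<open>Z * S\<close> vanishes, so does
    \<open>adj Z * P * Z\<close>, and Cauchy-Schwarz forces \<open>Z * X\<close> to vanish.\<close>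
  define Z where "Z = 1\<^sub>m n - S * R"
  have Z: "Z \<in> carrier_mat n n" "adj Z = Z" using S R
    by (simp_all add: Z_def minus_carrier_mat adj_minus[of _ n n] adj_mult[of _ n n _ n] aS)
  have SR: "S * (R * S) = S"
    using assoc[of S R S] assoc[of R S S] R S by simp
  have ZS: "Z * S = 0\<^sub>m n n"
    using S R SR by (simp add: Z_def minus_mult_distrib_mat[of _ n n _ _ n] left_mult_one_mat[of _ n n] assoc del: assoc_mult_mat)
  have ZZ: "Z * Z = Z"
  proof -
    have "Z * Z = Z - Z * (S * R)"
      using Z(1) S R mult_minus_distrib_mat[of Z n n "1\<^sub>m n" n "S * R"] by (simp add: Z_def[symmetric] right_mult_one_mat[of _ n n])
    also have "Z * (S * R) = 0\<^sub>m n n" using Z(1) S R ZS assoc[of Z S R] by simp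
    also have "Z - 0\<^sub>m n n = Z" using Z(1) by (intro eq_matI) auto
    finally show ?thesis .
  qed
  have "Z * X = 0\<^sub>m n n"
  proof (rule eq_matI)
    fix i j assume "i < dim_row (0\<^sub>m n n :: complex mat)" "j < dim_col (0\<^sub>m n n :: complex mat)"
    then have ij: "i < n" "j < n" by auto
    have "adj Z * P * Z = (Z * S) * (S * Z)"
      using Z S(1) by (simp add: S(3)[symmetric] assoc del: assoc_mult_mat)
    also have "\<dots> = 0\<^sub>m n n" using S Z(1) by (simp add: ZS)
    finally have "(adj Z * P * Z) $$ (i, i) = 0" using ij by simp
    then have "(Z * X) $$ (i, j) = 0"
      using four_block_cauchy_schwarz_entries[OF P(1) X Q(1) psd Q(2) Z(1) one_carrier_mat ij] Z X
      by (simp add: right_mult_one_mat[of _ n n] del: index_mult_mat(1))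
    then show "(Z * X) $$ (i, j) = 0\<^sub>m n n $$ (i, j)" using ij by simp
  qed (use Z X in auto)
  then have "X - S * R * X = 0\<^sub>m n n"
    using S R X minus_mult_distrib_mat[of "1\<^sub>m n" n n "S * R" X n] by (simp add: Z_def left_mult_one_mat[of _ n n])
  then have SRX: "X = S * R * X"
  proof -
    have "X = (X - S * R * X) + S * R * X" using S R X by (intro eq_matI) (auto simp del: index_mult_mat(1))
    then show ?thesis unfolding \<open>X - S * R * X = 0\<^sub>m n n\<close> using S R X by (simp add: left_add_zero_mat[of _ n n])
  qed
  define A B where "A = R * U" and "B = S * U"
  have AB: "A \<in> carrier_mat n n" "B \<in> carrier_mat n n" using R S Uc by (auto simp: A_def B_def)
  \<comment> \<open>From X = S R X, cyclicity gives tr X = tr (R X S); inserting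
    \<open>U * adj U\<close> passes to an eigenbasis of \<open>T\<close>, in which
    \<open>adj B * Q * B\<close> is diagonal with entries t^2.\<close>
  have "mtrace X = mtrace (R * X * S)"
    using mtrace_mult_comm[of S n n "R * X"] S R X SRX by (simp add: assoc del: assoc_mult_mat)
  also have "R * X * S = R * X * S * (U * adj U)" using R S X Uc by (simp add: right_mult_one_mat[of _ n n])
  also have "mtrace \<dots> = mtrace (adj A * X * B)"
    using mtrace_mult_comm[of "R * X * S * U" n n "adj U"] R S X Uc(1)
    by (simp add: A_def B_def adj_mult[of _ n n _ n] R(2) assoc del: assoc_mult_mat)
  finally have tr: "mtrace X = (\<Sum>i<n. (adj A * X * B) $$ (i, i))"
    using AB X by (simp add: mtrace_def del: index_mult_mat(1))
  have BQB: "adj B * Q * B = mat_diag n (\<lambda>i. of_real (t i * t i))"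
  proof -
    have "adj B * Q * B = adj U * (T * T) * U"
      using S(1) Q Uc(1) T(3) by (simp add: B_def adj_mult[of _ n n _ n] aS assoc del: assoc_mult_mat)
    then show ?thesis
      using spectral_sandwich[OF U] by (simp add: t(2) spectral_mult[OF U])
  qed
  \<comment> \<open>\<open>adj A * P * A\<close> is the projection \<open>S * R\<close> in the basis
    \<open>U\<close>, that is 1 - U^* Z U, and \<open>Z = adj Z * Z\<close> is positive.\<close>
  have APA: "Re ((adj A * P * A) $$ (i, i)) \<le> 1" if i: "i < n" for i
  proof -
    have "adj A * P * A = adj U * (R * (S * S) * R) * U"
      using R S(1) Uc(1) by (simp add: S(3)[symmetric] A_def adj_mult[of _ n n _ n] assoc del: assoc_mult_mat)
    also have "R * (S * S) * R = S * R" by (simp add: R(4))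
    finally have APA: "adj A * P * A = adj U * (S * R) * U" .
    have "adj U * Z * U = adj U * U - adj U * (S * R) * U"
      using R S Uc(1) by (simp add: Z_def mult_minus_distrib_mat[of _ n n _ n] minus_mult_distrib_mat[of _ n n _ _ n] right_mult_one_mat[of _ n n])
    then have "adj A * P * A = 1\<^sub>m n - adj U * Z * U"
      unfolding APA Uc(2) using R S Uc(1) by (intro eq_matI) (auto simp del: index_mult_mat(1))
    moreover have "0 \<le> Re ((adj U * Z * U) $$ (i, i))"
    proof (rule psd_diag(1)[OF _ _ i])
      show "psd (adj U * Z * U)"
        using psd_congruence[OF Z(1) _ Uc(1)] psd_adj_mult_self[OF Z(1)] Z ZZ by simp
    qed (use Uc Z in simp)
    ultimately show ?thesis using i Uc Z by (simp del: index_mult_mat(1))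
  qed
  have "Re ((adj A * X * B) $$ (i, i)) \<le> t i" if i: "i < n" for i
  proof -
    have "(cmod ((adj A * X * B) $$ (i, i)))\<^sup>2 \<le> Re ((adj A * P * A) $$ (i, i)) * (t i)\<^sup>2"
      using four_block_cauchy_schwarz_entries[OF P(1) X Q(1) psd Q(2) AB i i] i
      by (simp add: BQB mat_diag_def power2_eq_square del: index_mult_mat(1))
    also have "\<dots> \<le> 1 * (t i)\<^sup>2" by (rule mult_right_mono[OF APA[OF i]]) simp
    finally have "cmod ((adj A * X * B) $$ (i, i)) \<le> t i"
      using t(1)[of i] by (simp add: power2_le_iff_abs_le del: index_mult_mat(1))
    then show ?thesis using complex_Re_le_cmod order_trans by blast
  qed
  then have "Re (mtrace X) \<le> (\<Sum>i<n. t i)" unfolding tr Re_sum by (intro sum_mono) auto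
  also have "\<dots> = Re (mtrace T)" by (simp add: t(2) mtrace_spectral[OF U])
  finally show ?thesis by (simp add: fidelity_def T_def S_def)
qed

section \<open>Permuting the output systems\<close>

lemma sum_lessThan_times: "(\<Sum>i<m * k. f i) = (\<Sum>a<m. \<Sum>b<k. f (a * k + b))"
  for f :: "nat \<Rightarrow> 'a::comm_monoid_add"
proof (induction m)
  case (Suc m)
  have "Suc m * k = m * k + k" by simp
  then show ?case by (simp only: sum_add_lessThan Suc sum.lessThan_Suc)
qed simp

lemma pair_index_less: "a < m \<Longrightarrow> b < k \<Longrightarrow> a * k + b < m * (k::nat)"
proof -
  assume "a < m" "b < k"
  then have "a * k + b < Suc a * k" by simp
  also have "\<dots> \<le> m * k" using \<open>a < m\<close> by (intro mult_le_mono1) simp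
  finally show ?thesis .
qed

lemma pair_index_div_mod [simp]: "b < k \<Longrightarrow> (a * k + b) div k = a" "b < k \<Longrightarrow> (a * k + b) mod k = (b::nat)"
  by auto

text \<open>Horner evaluation of a digit string with position 0 most significant, the order that
  \<open>dig\<close> uses; it assembles indices from prescribed digits.\<close>

primrec undig :: "nat \<Rightarrow> nat \<Rightarrow> (nat \<Rightarrow> nat) \<Rightarrow> nat" where
  "undig d 0 f = 0"
| "undig d (Suc n) f = undig d n f * d + f n"

lemma dig_Suc: "p < n \<Longrightarrow> dig d (Suc n) i p = dig d n (i div d) p"
proof -
  assume "p < n"
  then have "n - p = Suc (n - 1 - p)" by simp
  then have "i div d ^ (n - p) = i div d div d ^ (n - 1 - p)"
    by (simp add: div_mult2_eq)
  then show ?thesis by (simp add: dig_def)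
qed

lemma dig_Suc_last [simp]: "dig d (Suc n) i n = i mod d"
  by (simp add: dig_def)

lemma dig_less: "0 < d \<Longrightarrow> dig d n i p < d"
  by (simp add: dig_def)

lemma undig_less: "(\<And>p. p < n \<Longrightarrow> f p < d) \<Longrightarrow> undig d n f < d ^ n"
  by (induction n) (auto simp: power_Suc2 intro!: pair_index_less simp del: power_Suc)

lemma dig_undig:
  assumes "\<And>p. p < n \<Longrightarrow> f p < d" "p < n"
  shows "dig d n (undig d n f) p = f p"
  using assms
proof (induction n)
  case (Suc n)
  then have "f n < d" by simp
  with Suc show ?case by (cases "p = n") (auto simp: dig_Suc less_Suc_eq)
qed simp

lemma dig_eqI:
  assumes "x < d ^ n" "y < d ^ n" "\<And>p. p < n \<Longrightarrow> dig d n x p = dig d n y p"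
  shows "x = y"
  using assms
proof (induction n arbitrary: x y)
  case (Suc n)
  have "x div d = y div d"
  proof (rule Suc.IH)
    show "x div d < d ^ n" using Suc.prems(1) unfolding power_Suc2 by (rule less_mult_imp_div_less)
    show "y div d < d ^ n" using Suc.prems(2) unfolding power_Suc2 by (rule less_mult_imp_div_less)
  next
    fix p assume "p < n"
    show "dig d n (x div d) p = dig d n (y div d) p"
      using Suc.prems(3)[OF less_SucI[OF \<open>p < n\<close>]] unfolding dig_Suc[OF \<open>p < n\<close>, symmetric] .
  qed
  moreover have "x mod d = y mod d" using Suc.prems(3)[OF lessI] unfolding dig_Suc_last .
  ultimately have "x div d * d + x mod d = y div d * d + y mod d" by (simp only:)
  then show ?case unfolding div_mult_mod_eq .
qed simp

text \<open>The index map behind \<open>Wperm\<close>: row \<open>x\<close> of that matrix has its 1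
  in the column \<open>permute_digits d n \<pi> x\<close>. It is a right action, so composition
  reverses the order.\<close>

definition permute_digits :: "nat \<Rightarrow> nat \<Rightarrow> (nat \<Rightarrow> nat) \<Rightarrow> nat \<Rightarrow> nat" where
  "permute_digits d n \<pi> x = undig d n (\<lambda>p. dig d n x (\<pi> p))"

context
  fixes d n :: nat
  assumes d: "0 < d"
begin

lemma permute_digits_less: "permute_digits d n \<pi> x < d ^ n"
  unfolding permute_digits_def by (rule undig_less) (simp add: dig_less d)

lemma dig_permute_digits: "p < n \<Longrightarrow> dig d n (permute_digits d n \<pi> x) p = dig d n x (\<pi> p)"
  unfolding permute_digits_def by (rule dig_undig) (auto simp: dig_less d)

lemma permute_digits_compose:
  assumes "\<sigma> permutes {..<n}"
  shows "permute_digits d n \<sigma> (permute_digits d n \<pi> x) = permute_digits d n (\<pi> \<circ> \<sigma>) x"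
proof (rule dig_eqI[OF permute_digits_less permute_digits_less])
  fix p assume p: "p < n"
  then have "\<sigma> p < n" using permutes_in_image[OF assms, of p] by simp
  with p show "dig d n (permute_digits d n \<sigma> (permute_digits d n \<pi> x)) p = dig d n (permute_digits d n (\<pi> \<circ> \<sigma>) x) p"
    by (simp add: dig_permute_digits)
qed

lemma permute_digits_id: "x < d ^ n \<Longrightarrow> permute_digits d n id x = x"
  by (erule dig_eqI[OF permute_digits_less]) (simp add: dig_permute_digits)

lemma permute_digits_inv:
  assumes "\<pi> permutes {..<n}" "x < d ^ n"
  shows "permute_digits d n \<pi> (permute_digits d n (Hilbert_Choice.inv \<pi>) x) = x"
    "permute_digits d n (Hilbert_Choice.inv \<pi>) (permute_digits d n \<pi> x) = x"
  unfolding permute_digits_compose[OF assms(1)] permute_digits_compose[OF permutes_inv[OF assms(1)]]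
    permutes_inv_o[OF assms(1)]
  by (rule permute_digits_id[OF assms(2)])+

lemma sum_permute_digits:
  assumes "\<pi> permutes {..<n}"
  shows "(\<Sum>x<d ^ n. f (permute_digits d n \<pi> x)) = (\<Sum>x<d ^ n. f x)"
  using permute_digits_inv[OF assms]
  by (intro sum.reindex_bij_witness[of _ "permute_digits d n (Hilbert_Choice.inv \<pi>)" "permute_digits d n \<pi>"])
    (auto simp: permute_digits_less)

text \<open>Substituting \<open>\<pi> p\<close> for \<open>p\<close> in the defining condition moves
  the inverse permutation away from the column index.\<close>

lemma Wperm_index:
  assumes "\<pi> permutes {..<n}" "x < d ^ n" "y < d ^ n"
  shows "Wperm d n \<pi> $$ (x, y) = (if y = permute_digits d n \<pi> x then 1 else 0)"
proof -
  have "(\<forall>p<n. dig d n x p = dig d n y (Hilbert_Choice.inv \<pi> p)) \<longleftrightarrow> y = permute_digits d n \<pi> x"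
  proof
    assume *: "\<forall>p<n. dig d n x p = dig d n y (Hilbert_Choice.inv \<pi> p)"
    show "y = permute_digits d n \<pi> x"
    proof (rule dig_eqI[OF assms(3) permute_digits_less])
      fix p assume "p < n"
      then have "\<pi> p < n" using permutes_in_image[OF assms(1), of p] by simp
      then have "dig d n x (\<pi> p) = dig d n y (Hilbert_Choice.inv \<pi> (\<pi> p))" using * by blast
      then show "dig d n y p = dig d n (permute_digits d n \<pi> x) p"
        unfolding permutes_inverses[OF assms(1)] dig_permute_digits[OF \<open>p < n\<close>] by (rule sym)
    qed
  next
    assume y: "y = permute_digits d n \<pi> x"
    show "\<forall>p<n. dig d n x p = dig d n y (Hilbert_Choice.inv \<pi> p)"
    proof (intro allI impI)
      fix p assume "p < n"
      then have "Hilbert_Choice.inv \<pi> p < n"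
        using permutes_in_image[OF permutes_inv[OF assms(1)], of p] by simp
      then show "dig d n x p = dig d n y (Hilbert_Choice.inv \<pi> p)"
        unfolding y by (subst dig_permute_digits) (simp_all only: permutes_inverses[OF assms(1)])
    qed
  qed
  then show ?thesis using assms by (simp add: Wperm_def)
qed

end

text \<open>Composing with the transposition of \<open>i\<close> and \<open>j\<close> shows that
  every position yields the same sum; added over all positions, each of the n! permutations
  contributes the full sum of \<open>g\<close>. The form without division serves both real
  fidelities and complex matrix entries.\<close>

lemma sum_permutes_apply:
  fixes g :: "nat \<Rightarrow> 'a::comm_semiring_1"
  assumes j: "j < n"
  shows "of_nat n * (\<Sum>\<pi>\<in>{\<pi>. \<pi> permutes {..<n}}. g (\<pi> j)) = of_nat (fact n) * (\<Sum>i<n. g i)"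
proof -
  let ?S = "{\<pi>. \<pi> permutes {..<n}}"
  have "(\<Sum>\<pi>\<in>?S. g (\<pi> i)) = (\<Sum>\<pi>\<in>?S. g (\<pi> j))" if "i < n" for i
    using sum_permutations_compose_right[OF permutes_swap_id[of i "{..<n}" j], of "\<lambda>\<pi>. g (\<pi> i)"] that j by simp
  then have "of_nat n * (\<Sum>\<pi>\<in>?S. g (\<pi> j)) = (\<Sum>i<n. \<Sum>\<pi>\<in>?S. g (\<pi> i))" by simp
  also have "\<dots> = (\<Sum>\<pi>\<in>?S. \<Sum>i<n. g (\<pi> i))" by (rule sum.swap)
  also have "\<dots> = (\<Sum>\<pi>\<in>?S. \<Sum>i<n. g i)"
  proof (rule sum.cong[OF refl])
    fix \<pi> assume "\<pi> \<in> ?S"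
    then show "(\<Sum>i<n. g (\<pi> i)) = (\<Sum>i<n. g i)"
      using sum.permute[of \<pi> "{..<n}" g] by (simp add: comp_def)
  qed
  also have "\<dots> = of_nat (fact n) * (\<Sum>i<n. g i)" by (simp add: card_permutations)
  finally show ?thesis .
qed

section \<open>Reindexings and nonnegative sums of positive matrices\<close>

lemma psd_reindex:
  assumes M: "M \<in> carrier_mat n n" "psd M" and f: "\<And>i. i < m \<Longrightarrow> f i < n"
  shows "psd (mat m m (\<lambda>(i, j). M $$ (f i, f j)))"
proof -
  \<comment> \<open>Column \<open>j\<close> of \<open>L\<close> is the basis vector
    \<open>f j\<close>, so the reindexed matrix is a congruence of \<open>M\<close>.\<close>
  define L :: "complex mat" where "L = mat n m (\<lambda>(k, j). if k = f j then 1 else 0)"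
  have L: "L \<in> carrier_mat n m" by (simp add: L_def)
  have "adj L * M * L = mat m m (\<lambda>(i, j). M $$ (f i, f j))"
  proof (rule eq_matI)
    fix i j assume "i < dim_row (mat m m (\<lambda>(i, j). M $$ (f i, f j)))" "j < dim_col (mat m m (\<lambda>(i, j). M $$ (f i, f j)))"
    then have ij: "i < m" "j < m" by auto
    have "(adj L * M * L) $$ (i, j) = sform n M (\<lambda>k. if k = f i then 1 else 0) (\<lambda>k. if k = f j then 1 else 0)"
      unfolding sandwich_index[OF M(1) L L ij] sform_def using ij by (auto intro!: sum.cong simp: L_def)
    then show "(adj L * M * L) $$ (i, j) = mat m m (\<lambda>(i, j). M $$ (f i, f j)) $$ (i, j)"
      using ij f by (simp add: sform_delta)
  qed (use L in auto)
  then show ?thesis using psd_congruence[OF M L] by simp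
qed

text \<open>The entrywise form is the shape in which channel outputs, marginals, twirls and averaged
  block matrices present themselves.\<close>

lemma psd_nonneg_sum:
  assumes "\<And>x. x \<in> I \<Longrightarrow> F x \<in> carrier_mat n n" "\<And>x. x \<in> I \<Longrightarrow> psd (F x)" "0 \<le> c"
  shows "psd (mat n n (\<lambda>(i, j). of_real c * (\<Sum>x\<in>I. F x $$ (i, j))))" (is "psd ?M")
proof -
  have M: "?M \<in> carrier_mat n n" by simp
  have "adj ?M = ?M"
  proof (rule eq_matI)
    fix i j assume "i < dim_row ?M" "j < dim_col ?M"
    then have ij: "i < n" "j < n" by auto
    have "cnj (F x $$ (j, i)) = F x $$ (i, j)" if "x \<in> I" for x
      using assms(1,2)[OF that] ij psd_iff[of "F x" n] adj_index[of i "F x" j] by auto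
    then show "adj ?M $$ (i, j) = ?M $$ (i, j)" using ij by simp
  qed auto
  moreover have "sform n ?M v v = of_real c * (\<Sum>x\<in>I. sform n (F x) v v)" for v
  proof -
    have "sform n ?M v v = (\<Sum>i<n. \<Sum>j<n. \<Sum>x\<in>I. of_real c * (cnj (v i) * F x $$ (i, j) * v j))"
      unfolding sform_def by (intro sum.cong refl) (simp add: sum_distrib_left sum_distrib_right mult_ac)
    also have "\<dots> = (\<Sum>i<n. \<Sum>x\<in>I. \<Sum>j<n. of_real c * (cnj (v i) * F x $$ (i, j) * v j))"
      by (intro sum.cong refl sum.swap)
    also have "\<dots> = (\<Sum>x\<in>I. \<Sum>i<n. \<Sum>j<n. of_real c * (cnj (v i) * F x $$ (i, j) * v j))"
      by (rule sum.swap)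
    finally show ?thesis by (simp add: sform_def sum_distrib_left)
  qed
  moreover have "0 \<le> Re (sform n (F x) v v)" if "x \<in> I" for x v
    using assms(1,2)[OF that] psd_iff[of "F x" n] by blast
  ultimately show ?thesis unfolding psd_iff[OF M] using assms(3) by (auto intro!: mult_nonneg_nonneg sum_nonneg)
qed

section \<open>Channels and Choi matrices\<close>

text \<open>The map with Choi matrix \<open>J\<close>, tensored with the identity in dimension
  \<open>k\<close> and applied to \<open>M\<close>; \<open>k = 1\<close> gives the map itself.
  Contracting row with row and column with column accounts for the transpose in tr_A(J^T_A
  M).\<close>

definition choi_out :: "nat \<Rightarrow> nat \<Rightarrow> nat \<Rightarrow> complex mat \<Rightarrow> complex mat \<Rightarrow> complex mat" where
  "choi_out m N k J M = mat (N * k) (N * k) (\<lambda>(i, j). \<Sum>a<m. \<Sum>a'<m.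
     J $$ (a * N + i div k, a' * N + j div k) * M $$ (a * k + i mod k, a' * k + j mod k))"

lemma choi_out_carrier [simp]: "choi_out m N k J M \<in> carrier_mat (N * k) (N * k)"
  by (simp add: choi_out_def)

lemma choi_out_index:
  "x < N \<Longrightarrow> b < k \<Longrightarrow> x' < N \<Longrightarrow> b' < k \<Longrightarrow> choi_out m N k J M $$ (x * k + b, x' * k + b') =
    (\<Sum>a<m. \<Sum>a'<m. J $$ (a * N + x, a' * N + x') * M $$ (a * k + b, a' * k + b'))"
  by (simp add: choi_out_def pair_index_less)

lemma pair_index_cases:
  assumes "i < N * (k::nat)"
  obtains x b where "x < N" "b < k" "i = x * k + b"
proof -
  have "0 < k" using assms by (cases k) auto
  moreover have "i div k < N" using assms by (simp add: less_mult_imp_div_less)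
  ultimately show thesis using that[of "i div k" "i mod k"] by simp
qed

lemma eq_mat_pairI:
  assumes "A \<in> carrier_mat (N * k) (N * k)" "B \<in> carrier_mat (N * k) (N * k)"
    and "\<And>x b x' b'. x < N \<Longrightarrow> b < k \<Longrightarrow> x' < N \<Longrightarrow> b' < k \<Longrightarrow>
      A $$ (x * k + b, x' * k + b') = B $$ (x * k + b, x' * k + b')"
  shows "A = B"
proof (rule eq_matI)
  fix i j assume "i < dim_row B" "j < dim_col B"
  then have "i < N * k" "j < N * k" using assms by auto
  then show "A $$ (i, j) = B $$ (i, j)" using assms(3) by (metis pair_index_cases)
qed (use assms in auto)

lemma sform_pair:
  "sform (m * N) M u v = (\<Sum>a<m. \<Sum>x<N. \<Sum>a'<m. \<Sum>x'<N. cnj (u (a * N + x)) * M $$ (a * N + x, a' * N + x') * v (a' * N + x'))"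
  by (simp add: sform_def sum_lessThan_times)

text \<open>A positive Choi matrix gives a completely positive map. The rows of a Hermitian root
  \<open>S\<close> split \<open>M\<close> into rank-one terms, and the term of row \<open>r\<close>
  contributes the congruence of \<open>J\<close> by \<open>L r\<close>, which is that row reshaped
  on the input and the identity on the output.\<close>

lemma psd_choi_out:
  assumes J: "J \<in> carrier_mat (m * N) (m * N)" "psd J" and M: "M \<in> carrier_mat (m * k) (m * k)" "psd M"
  shows "psd (choi_out m N k J M)"
proof -
  obtain S where S: "S \<in> carrier_mat (m * k) (m * k)" "psd S" "S * S = M" by (rule psd_square_root_exists[OF M])
  define L where "L r = mat (m * N) (N * k) (\<lambda>(p, i).
    if p mod N = i div k then S $$ (r, (p div N) * k + i mod k) else 0)" for r
  have L: "L r \<in> carrier_mat (m * N) (N * k)" for r by (simp add: L_def)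
  have Lidx: "L r $$ (a * N + y, x * k + b) = (if y = x then S $$ (r, a * k + b) else 0)"
    if "a < m" "y < N" "x < N" "b < k" for r a y x b
    using that by (simp add: L_def pair_index_less)
  have Midx: "M $$ (i, j) = (\<Sum>r<m * k. cnj (S $$ (r, i)) * S $$ (r, j))" if "i < m * k" "j < m * k" for i j
  proof -
    have "S $$ (i, r) = cnj (S $$ (r, i))" if "r < m * k" for r
      using S psd_iff[OF S(1)] adj_index[of i S r] \<open>i < m * k\<close> that by auto
    then show ?thesis using index_mult_mat_sum[OF S(1) S(1) that] by (simp add: S(3))
  qed
  have "choi_out m N k J M = mat (N * k) (N * k) (\<lambda>(i, j). of_real 1 * (\<Sum>r<m * k. (adj (L r) * J * L r) $$ (i, j)))"
  proof (rule eq_mat_pairI)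
    fix x b x' b' assume *: "x < N" "b < k" "x' < N" "b' < k"
    have "(adj (L r) * J * L r) $$ (x * k + b, x' * k + b') =
        (\<Sum>a<m. \<Sum>a'<m. cnj (S $$ (r, a * k + b)) * J $$ (a * N + x, a' * N + x') * S $$ (r, a' * k + b'))" for r
    proof -
      have "(adj (L r) * J * L r) $$ (x * k + b, x' * k + b') =
          (\<Sum>a<m. \<Sum>y<N. \<Sum>a'<m. \<Sum>y'<N. if y = x then if y' = x' then
            cnj (S $$ (r, a * k + b)) * J $$ (a * N + x, a' * N + x') * S $$ (r, a' * k + b') else 0 else 0)"
        using * by (subst sandwich_index[OF J(1) L L]) (auto simp: pair_index_less sform_pair Lidx intro!: sum.cong)
      also have "\<dots> = (\<Sum>a<m. \<Sum>y<N. if y = x then \<Sum>a'<m. \<Sum>y'<N. if y' = x' then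
            cnj (S $$ (r, a * k + b)) * J $$ (a * N + x, a' * N + x') * S $$ (r, a' * k + b') else 0 else 0)"
        by (intro sum.cong refl) auto
      finally show ?thesis using * by simp
    qed
    then have "(\<Sum>r<m * k. (adj (L r) * J * L r) $$ (x * k + b, x' * k + b')) =
        (\<Sum>r<m * k. \<Sum>a<m. \<Sum>a'<m. cnj (S $$ (r, a * k + b)) * J $$ (a * N + x, a' * N + x') * S $$ (r, a' * k + b'))"
      by simp
    also have "\<dots> = (\<Sum>a<m. \<Sum>r<m * k. \<Sum>a'<m. cnj (S $$ (r, a * k + b)) * J $$ (a * N + x, a' * N + x') * S $$ (r, a' * k + b'))"
      by (rule sum.swap)
    also have "\<dots> = (\<Sum>a<m. \<Sum>a'<m. \<Sum>r<m * k. cnj (S $$ (r, a * k + b)) * J $$ (a * N + x, a' * N + x') * S $$ (r, a' * k + b'))"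
      by (intro sum.cong refl sum.swap)
    also have "\<dots> = (\<Sum>a<m. \<Sum>a'<m. J $$ (a * N + x, a' * N + x') * M $$ (a * k + b, a' * k + b'))"
      using * by (intro sum.cong refl) (simp add: Midx pair_index_less sum_distrib_left, simp add: mult_ac)
    finally show "choi_out m N k J M $$ (x * k + b, x' * k + b') =
        mat (N * k) (N * k) (\<lambda>(i, j). of_real 1 * (\<Sum>r<m * k. (adj (L r) * J * L r) $$ (i, j))) $$ (x * k + b, x' * k + b')"
      using * by (simp add: choi_out_index pair_index_less)
  qed auto
  moreover have "psd (mat (N * k) (N * k) (\<lambda>(i, j). of_real 1 * (\<Sum>r<m * k. (adj (L r) * J * L r) $$ (i, j))))"
    using L J by (intro psd_nonneg_sum psd_congruence[OF J L]) (auto intro!: mult_carrier_mat)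
  ultimately show ?thesis by simp
qed

lemma chan_tensor_id_choi_out:
  "chan_tensor_id (choi_out m N 1 J) m N k M = choi_out m N k J M"
  by (rule eq_mat_pairI[of _ N k]) (auto simp: chan_tensor_id_def choi_out_def pair_index_less)

lemma quantum_channel_choi_out:
  assumes J: "J \<in> carrier_mat (m * N) (m * N)" "psd J" and tp: "ptrace_second m N J = 1\<^sub>m m"
  shows "quantum_channel m N (choi_out m N 1 J)"
  unfolding quantum_channel_def
proof (intro conjI ballI allI impI)
  fix X :: "complex mat" assume X: "X \<in> carrier_mat m m"
  show "choi_out m N 1 J X \<in> carrier_mat N N" using choi_out_carrier[of m N 1 J X] by simp
  have t: "(\<Sum>x<N. J $$ (a * N + x, a' * N + x)) = (if a = a' then 1 else 0)" if "a < m" "a' < m" for a a'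
    using arg_cong[OF tp, of "\<lambda>A. A $$ (a, a')"] that by (simp add: ptrace_second_def)
  have "mtrace (choi_out m N 1 J X) = (\<Sum>x<N. \<Sum>a<m. \<Sum>a'<m. J $$ (a * N + x, a' * N + x) * X $$ (a, a'))"
    by (simp add: mtrace_def choi_out_def)
  also have "\<dots> = (\<Sum>a<m. \<Sum>x<N. \<Sum>a'<m. J $$ (a * N + x, a' * N + x) * X $$ (a, a'))"
    by (rule sum.swap)
  also have "\<dots> = (\<Sum>a<m. \<Sum>a'<m. \<Sum>x<N. J $$ (a * N + x, a' * N + x) * X $$ (a, a'))"
    by (intro sum.cong refl sum.swap)
  also have "\<dots> = (\<Sum>a<m. \<Sum>a'<m. if a = a' then X $$ (a, a') else 0)"
    by (intro sum.cong refl) (simp add: sum_distrib_right[symmetric] t)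
  also have "\<dots> = mtrace X" using X by (simp add: mtrace_def)
  finally show "mtrace (choi_out m N 1 J X) = mtrace X" .
  fix Y :: "complex mat" and c assume Y: "Y \<in> carrier_mat m m"
  show "choi_out m N 1 J (c \<cdot>\<^sub>m X + Y) = c \<cdot>\<^sub>m choi_out m N 1 J X + choi_out m N 1 J Y"
    using X Y by (intro eq_matI) (auto simp: choi_out_def distrib_left sum.distrib sum_distrib_left mult.left_commute[of _ c])
next
  fix k M assume "M \<in> carrier_mat (m * k) (m * k)" "psd M"
  then show "psd (chan_tensor_id (choi_out m N 1 J) m N k M)"
    unfolding chan_tensor_id_choi_out by (rule psd_choi_out[OF J])
qed

definition mat_unit :: "nat \<Rightarrow> nat \<Rightarrow> nat \<Rightarrow> complex mat" where
  "mat_unit m a a' = mat m m (\<lambda>(i, j). if i = a \<and> j = a' then 1 else 0)"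

definition choi :: "nat \<Rightarrow> nat \<Rightarrow> (complex mat \<Rightarrow> complex mat) \<Rightarrow> complex mat" where
  "choi m N \<Lambda> = mat (m * N) (m * N) (\<lambda>(i, j). \<Lambda> (mat_unit m (i div N) (j div N)) $$ (i mod N, j mod N))"

lemma choi_carrier [simp]: "choi m N \<Lambda> \<in> carrier_mat (m * N) (m * N)"
  by (simp add: choi_def)

text \<open>\<open>quantum_channel\<close> gives linearity for two summands only, so the expansion
  in matrix units is built up entry by entry over a finite set of index pairs.\<close>

lemma quantum_channel_expand:
  assumes \<Lambda>: "quantum_channel m N \<Lambda>" and X: "X \<in> carrier_mat m m" and x: "x < N" "x' < N"
  shows "\<Lambda> X $$ (x, x') = (\<Sum>a<m. \<Sum>a'<m. X $$ (a, a') * \<Lambda> (mat_unit m a a') $$ (x, x'))"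
proof -
  have car: "\<Lambda> Y \<in> carrier_mat N N" if "Y \<in> carrier_mat m m" for Y
    using \<Lambda> that by (simp add: quantum_channel_def)
  have lin: "\<Lambda> (c \<cdot>\<^sub>m Y + Z) = c \<cdot>\<^sub>m \<Lambda> Y + \<Lambda> Z" if "Y \<in> carrier_mat m m" "Z \<in> carrier_mat m m" for c Y Z
    using \<Lambda> that by (simp add: quantum_channel_def)
  have u: "mat_unit m a a' \<in> carrier_mat m m" for a a' by (simp add: mat_unit_def)
  have "\<Lambda> (mat m m (\<lambda>q. if q \<in> S then X $$ q else 0)) $$ (x, x') =
      (\<Sum>(a, a')\<in>S. X $$ (a, a') * \<Lambda> (mat_unit m a a') $$ (x, x'))" if "finite S" for S
    using that
  proof (induction S rule: finite_induct)
    case empty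
    let ?O = "mat m m (\<lambda>q. 0) :: complex mat"
    \<comment> \<open>The zero matrix is 1 O + O, so its image equals twice itself and
      vanishes.\<close>
    have "\<Lambda> ?O = \<Lambda> (1 \<cdot>\<^sub>m ?O + ?O)" by (intro arg_cong[of _ _ \<Lambda>] eq_matI) auto
    also have "\<dots> = 1 \<cdot>\<^sub>m \<Lambda> ?O + \<Lambda> ?O" by (rule lin) auto
    finally have "\<Lambda> ?O $$ (x, x') = (1 \<cdot>\<^sub>m \<Lambda> ?O + \<Lambda> ?O) $$ (x, x')" by simp
    then show ?case using car[of ?O] x by simp
  next
    case (insert q S)
    obtain a a' where q: "q = (a, a')" by force
    let ?R = "mat m m (\<lambda>q. if q \<in> S then X $$ q else 0)"
    have "mat m m (\<lambda>p. if p \<in> insert q S then X $$ p else 0) = X $$ q \<cdot>\<^sub>m mat_unit m a a' + ?R"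
      using insert.hyps by (intro eq_matI) (auto simp: q mat_unit_def)
    then have "\<Lambda> (mat m m (\<lambda>p. if p \<in> insert q S then X $$ p else 0)) = X $$ q \<cdot>\<^sub>m \<Lambda> (mat_unit m a a') + \<Lambda> ?R"
      using lin[OF u] by simp
    then show ?case using insert.IH insert.hyps car[OF u[of a a']] car[of ?R] x by (simp add: q)
  qed
  from this[of "{..<m} \<times> {..<m}"] have "\<Lambda> (mat m m (\<lambda>q. if q \<in> {..<m} \<times> {..<m} then X $$ q else 0)) $$ (x, x') =
      (\<Sum>a<m. \<Sum>a'<m. X $$ (a, a') * \<Lambda> (mat_unit m a a') $$ (x, x'))"
    by (simp add: sum.cartesian_product)
  moreover have "mat m m (\<lambda>q. if q \<in> {..<m} \<times> {..<m} then X $$ q else 0) = X"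
    using X by (intro eq_matI) auto
  ultimately show ?thesis by simp
qed

lemma chan_tensor_id_choi:
  assumes \<Lambda>: "quantum_channel m N \<Lambda>"
  shows "chan_tensor_id \<Lambda> m N k M = choi_out m N k (choi m N \<Lambda>) M"
proof (rule eq_mat_pairI[of _ N k])
  fix x b x' b' assume *: "x < N" "b < k" "x' < N" "b' < k"
  show "chan_tensor_id \<Lambda> m N k M $$ (x * k + b, x' * k + b') = choi_out m N k (choi m N \<Lambda>) M $$ (x * k + b, x' * k + b')"
    using * by (simp add: choi_out_index chan_tensor_id_def pair_index_less choi_def quantum_channel_expand[OF \<Lambda>])
      (simp add: mult.commute)
qed (auto simp: chan_tensor_id_def)

text \<open>The other half of Choi's theorem: \<open>\<Omega>\<close> is the unnormalised maximally
  entangled projector, \<open>L\<close> being the corresponding row vector. The channel acts on the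
  first factor, so its output carries the systems in the order output, input;
  \<open>psd_reindex\<close> swaps them.\<close>

lemma psd_choi:
  assumes \<Lambda>: "quantum_channel m N \<Lambda>"
  shows "psd (choi m N \<Lambda>)"
proof -
  define L :: "complex mat" where "L = mat 1 (m * m) (\<lambda>(i, j). if j div m = j mod m then 1 else 0)"
  define \<Omega> where "\<Omega> = adj L * L"
  have L: "L \<in> carrier_mat 1 (m * m)" by (simp add: L_def)
  have \<Omega>: "\<Omega> \<in> carrier_mat (m * m) (m * m)" "psd \<Omega>"
    using L psd_adj_mult_self[OF L] by (auto simp: \<Omega>_def)
  have \<Omega>idx: "\<Omega> $$ (a * m + c, a' * m + c') = (if a = c \<and> a' = c' then 1 else 0)" if "a < m" "c < m" "a' < m" "c' < m" for a c a' c'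
    unfolding \<Omega>_def using that L
    by (subst index_mult_mat_sum[of _ "m * m" 1 _ "m * m"]) (auto simp: L_def pair_index_less)
  have "psd (chan_tensor_id \<Lambda> m N m \<Omega>)" using \<Lambda> \<Omega> by (simp add: quantum_channel_def)
  then have "psd (mat (m * N) (m * N) (\<lambda>(i, j). chan_tensor_id \<Lambda> m N m \<Omega> $$
      ((i mod N) * m + i div N, (j mod N) * m + j div N)))"
  proof (rule psd_reindex[rotated])
    fix i assume "i < m * N"
    then show "i mod N * m + i div N < N * m"
      by (metis pair_index_cases pair_index_div_mod pair_index_less)
  qed (simp add: chan_tensor_id_def)
  also have "mat (m * N) (m * N) (\<lambda>(i, j). chan_tensor_id \<Lambda> m N m \<Omega> $$
      ((i mod N) * m + i div N, (j mod N) * m + j div N)) = choi m N \<Lambda>"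
  proof (rule eq_mat_pairI)
    fix a x a' x' assume *: "a < m" "x < N" "a' < m" "x' < N"
    have "mat m m (\<lambda>(c, c'). \<Omega> $$ (c * m + a, c' * m + a')) = mat_unit m a a'"
      using * by (intro eq_matI) (auto simp: mat_unit_def \<Omega>idx)
    then show "mat (m * N) (m * N) (\<lambda>(i, j). chan_tensor_id \<Lambda> m N m \<Omega> $$
      ((i mod N) * m + i div N, (j mod N) * m + j div N)) $$ (a * N + x, a' * N + x') = choi m N \<Lambda> $$ (a * N + x, a' * N + x')"
      using * by (simp add: pair_index_less choi_def chan_tensor_id_def)
  qed auto
  finally show ?thesis .
qed

lemma ptrace_second_choi:
  assumes \<Lambda>: "quantum_channel m N \<Lambda>"
  shows "ptrace_second m N (choi m N \<Lambda>) = 1\<^sub>m m"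
proof (rule eq_matI)
  fix a a' assume "a < dim_row (1\<^sub>m m :: complex mat)" "a' < dim_col (1\<^sub>m m :: complex mat)"
  then have a: "a < m" "a' < m" by auto
  have u: "mat_unit m a a' \<in> carrier_mat m m" by (simp add: mat_unit_def)
  then have "\<Lambda> (mat_unit m a a') \<in> carrier_mat N N" "mtrace (\<Lambda> (mat_unit m a a')) = mtrace (mat_unit m a a')"
    using \<Lambda> by (auto simp: quantum_channel_def)
  then have "(\<Sum>x<N. \<Lambda> (mat_unit m a a') $$ (x, x)) = mtrace (mat_unit m a a')" by (simp add: mtrace_def)
  also have "\<dots> = (\<Sum>i<m. if i = a then (if a = a' then 1 else 0) else 0)"
    unfolding mtrace_def mat_unit_def by (intro sum.cong) auto
  finally show "ptrace_second m N (choi m N \<Lambda>) $$ (a, a') = 1\<^sub>m m $$ (a, a')"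
    using a by (simp add: ptrace_second_def choi_def pair_index_less)
qed (auto simp: ptrace_second_def)

section \<open>Marginals and twirling\<close>

text \<open>A matrix product contracts a column index with a row index; the transpose on A exchanges
  these for \<open>J\<close>, which yields the contraction of \<open>choi_out\<close>. So the
  operator in the semidefinite program is a channel output.\<close>

lemma ptrace_first_choi_out:
  assumes J: "J \<in> carrier_mat (m * N) (m * N)" and M: "M \<in> carrier_mat (m * k) (m * k)"
  shows "ptrace_first m (N * k) (kron (ptransA m N J) (1\<^sub>m k) * embed_mid m N k M) = choi_out m N k J M"
proof (rule eq_mat_pairI[of _ N k])
  fix x b x' b' assume *: "x < N" "b < k" "x' < N" "b' < k"
  define K where "K = kron (ptransA m N J) (1\<^sub>m k)"
  define E where "E = embed_mid m N k M"
  have K: "K \<in> carrier_mat (m * N * k) (m * N * k)" by (simp add: K_def kron_def ptransA_def carrier_matI)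
  have E: "E \<in> carrier_mat (m * N * k) (m * N * k)" by (simp add: E_def embed_mid_def)
  have Kidx: "K $$ ((a * N + y) * k + e, (a' * N + y') * k + e') = (if e' = e then J $$ (a' * N + y, a * N + y') else 0)"
    if "a < m" "y < N" "e < k" "a' < m" "y' < N" "e' < k" for a y e a' y' e'
    using that by (simp add: K_def kron_def ptransA_def pair_index_less)
  have dv: "((a * N + y) * k + e) div (N * k) = a" if "y < N" "e < k" for a y e
    using that by (simp add: mult.commute[of N k] div_mult2_eq)
  have Eidx: "E $$ ((a * N + y) * k + e, (a' * N + y') * k + e') = (if y = y' then M $$ (a * k + e, a' * k + e') else 0)"
    if "a < m" "y < N" "e < k" "a' < m" "y' < N" "e' < k" for a y e a' y' e'
    using that by (simp add: E_def embed_mid_def pair_index_less dv)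
  have "(K * E) $$ (a * (N * k) + (x * k + b), a * (N * k) + (x' * k + b')) =
      (\<Sum>c<m. J $$ (c * N + x, a * N + x') * M $$ (c * k + b, a * k + b'))" if a: "a < m" for a
  proof -
    have assoc: "a * (N * k) + (y * k + e) = (a * N + y) * k + e" for y e by (simp add: algebra_simps)
    have "(K * E) $$ ((a * N + x) * k + b, (a * N + x') * k + b') =
        (\<Sum>c<m. \<Sum>y<N. \<Sum>e<k. K $$ ((a * N + x) * k + b, (c * N + y) * k + e) * E $$ ((c * N + y) * k + e, (a * N + x') * k + b'))"
      using a * by (subst index_mult_mat_sum[OF K E]) (simp_all add: pair_index_less sum_lessThan_times)
    also have "\<dots> = (\<Sum>c<m. \<Sum>y<N. \<Sum>e<k. if y = x' then if e = b then J $$ (c * N + x, a * N + x') * M $$ (c * k + b, a * k + b') else 0 else 0)"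
      using a * by (intro sum.cong refl) (simp add: Kidx Eidx)
    also have "\<dots> = (\<Sum>c<m. \<Sum>y<N. if y = x' then (\<Sum>e<k. if e = b then J $$ (c * N + x, a * N + x') * M $$ (c * k + b, a * k + b') else 0) else 0)"
      by (intro sum.cong refl) simp
    finally show ?thesis unfolding assoc using * by simp
  qed
  then have "ptrace_first m (N * k) (K * E) $$ (x * k + b, x' * k + b') =
      (\<Sum>a<m. \<Sum>c<m. J $$ (c * N + x, a * N + x') * M $$ (c * k + b, a * k + b'))"
    using * by (simp add: ptrace_first_def pair_index_less del: index_mult_mat(1))
  also have "\<dots> = choi_out m N k J M $$ (x * k + b, x' * k + b')"
    using * by (subst sum.swap) (simp add: choi_out_index)
  finally show "ptrace_first m (N * k) (kron (ptransA m N J) (1\<^sub>m k) * embed_mid m N k M) $$ (x * k + b, x' * k + b') =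
      choi_out m N k J M $$ (x * k + b, x' * k + b')"
    by (simp add: K_def E_def)
qed (auto simp: ptrace_first_def)

lemma reduced_op_choi_out:
  assumes "J \<in> carrier_mat (m * m ^ n) (m * m ^ n)" "M \<in> carrier_mat (m * k) (m * k)"
  shows "reduced_op m k n J M = marg m n k 0 (choi_out m (m ^ n) k J M)"
  using assms by (simp add: reduced_op_def ptrace_first_choi_out)

lemma marg_carrier [simp]: "marg m n k j M \<in> carrier_mat (m * k) (m * k)"
  by (simp add: marg_def)

definition marg_match :: "nat \<Rightarrow> nat \<Rightarrow> nat \<Rightarrow> nat \<Rightarrow> nat \<Rightarrow> nat \<Rightarrow> nat \<Rightarrow> bool" where
  "marg_match d n j a a' x x' \<longleftrightarrow> dig d n x j = a \<and> dig d n x' j = a' \<and> (\<forall>p<n. p \<noteq> j \<longrightarrow> dig d n x p = dig d n x' p)"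

lemma marg_index:
  "a < d \<Longrightarrow> b < k \<Longrightarrow> a' < d \<Longrightarrow> b' < k \<Longrightarrow> marg d n k j M $$ (a * k + b, a' * k + b') =
    (\<Sum>x<d ^ n. \<Sum>x'<d ^ n. if marg_match d n j a a' x x' then M $$ (x * k + b, x' * k + b') else 0)"
  by (simp add: marg_def marg_match_def pair_index_less cong: if_cong)

text \<open>Tracing out is a sum of compressions \<open>L\<^sub>z\<^sup>* M L\<^sub>z\<close> over the basis states of the discarded
  systems; such a state is encoded by the index \<open>z\<close> whose digit at the kept position \<open>j\<close> is 0.\<close>
lemma psd_marg:
  assumes M: "M \<in> carrier_mat (d ^ n * k) (d ^ n * k)" "psd M" and j: "j < n" and d: "0 < d"
  shows "psd (marg d n k j M)"
proof -
  define C where "C x z \<longleftrightarrow> (\<forall>p<n. p \<noteq> j \<longrightarrow> dig d n x p = dig d n z p)" for x z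
  define Z where "Z = {z. z < d ^ n \<and> dig d n z j = 0}"
  have Z: "finite Z" by (simp add: Z_def)
  \<comment> \<open>\<open>r x\<close> is the element of \<open>Z\<close> that agrees with
    \<open>x\<close> off position \<open>j\<close>.\<close>
  define r where "r x = undig d n (\<lambda>p. if p = j then 0 else dig d n x p)" for x
  have rl: "r x < d ^ n" for x unfolding r_def by (rule undig_less) (simp add: dig_less d)
  have rd: "dig d n (r x) p = (if p = j then 0 else dig d n x p)" if "p < n" for x p
    unfolding r_def using that by (subst dig_undig) (auto simp: dig_less d)
  have CZ: "C x z \<longleftrightarrow> z = r x" if "z \<in> Z" for x z
  proof
    assume "C x z"
    show "z = r x"
    proof (rule dig_eqI[OF _ rl])
      fix p assume "p < n"
      then show "dig d n z p = dig d n (r x) p" using \<open>C x z\<close> that by (auto simp: rd C_def Z_def)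
    qed (use that in \<open>simp add: Z_def\<close>)
  qed (simp add: C_def rd)
  have mm: "marg_match d n j a a' x x' \<longleftrightarrow> dig d n x j = a \<and> dig d n x' j = a' \<and> C x x'" for a a' x x'
    by (simp add: marg_match_def C_def)
  have rZ: "r x \<in> Z" for x using rl j by (simp add: Z_def rd)
  have Cr: "C x' (r x) \<longleftrightarrow> C x x'" for x x' by (auto simp: C_def rd)
  define L where "L z = mat (d ^ n * k) (d * k) (\<lambda>(p, i).
    if p mod k = i mod k \<and> dig d n (p div k) j = i div k \<and> C (p div k) z then 1 else 0 :: complex)" for z
  have L: "L z \<in> carrier_mat (d ^ n * k) (d * k)" for z by (simp add: L_def)
  have Lidx: "L z $$ (x * k + e, a * k + b) = (if e = b then if dig d n x j = a \<and> C x z then 1 else 0 else 0)"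
    if "x < d ^ n" "e < k" "a < d" "b < k" for x e a b z
    using that by (simp add: L_def pair_index_less)
  have "marg d n k j M = mat (d * k) (d * k) (\<lambda>(i, i'). of_real 1 * (\<Sum>z\<in>Z. (adj (L z) * M * L z) $$ (i, i')))"
  proof (rule eq_mat_pairI)
    fix a b a' b' assume *: "a < d" "b < k" "a' < d" "b' < k"
    have "(adj (L z) * M * L z) $$ (a * k + b, a' * k + b') =
        (\<Sum>x<d ^ n. \<Sum>x'<d ^ n. if z = r x then if marg_match d n j a a' x x' then M $$ (x * k + b, x' * k + b') else 0 else 0)"
      if "z \<in> Z" for z
    proof -
      \<comment> \<open>Both \<open>x\<close> and \<open>x'\<close> restrict to the discarded state
        \<open>z\<close> exactly when \<open>z = r x\<close> and the two agree off position
        \<open>j\<close>. Summing over \<open>z\<close> therefore counts each matching pair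
        once.\<close>
      have eqv: "(dig d n x j = a \<and> C x z \<and> dig d n x' j = a' \<and> C x' z) \<longleftrightarrow> (z = r x \<and> marg_match d n j a a' x x')" for x x'
        unfolding mm CZ[OF that, of x] by (cases "z = r x") (simp_all add: Cr)
      have "(adj (L z) * M * L z) $$ (a * k + b, a' * k + b') = (\<Sum>x<d ^ n. \<Sum>e<k. \<Sum>x'<d ^ n. \<Sum>e'<k.
          if e = b then if e' = b' then if dig d n x j = a \<and> C x z \<and> dig d n x' j = a' \<and> C x' z
          then M $$ (x * k + b, x' * k + b') else 0 else 0 else 0)"
        using * by (subst sandwich_index[OF M(1) L L]) (auto simp: pair_index_less sform_pair Lidx intro!: sum.cong)
      also have "\<dots> = (\<Sum>x<d ^ n. \<Sum>e<k. if e = b then \<Sum>x'<d ^ n. \<Sum>e'<k.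
          if e' = b' then if dig d n x j = a \<and> C x z \<and> dig d n x' j = a' \<and> C x' z
          then M $$ (x * k + b, x' * k + b') else 0 else 0 else 0)"
        by (intro sum.cong refl) simp
      also have "\<dots> = (\<Sum>x<d ^ n. \<Sum>x'<d ^ n. if dig d n x j = a \<and> C x z \<and> dig d n x' j = a' \<and> C x' z
          then M $$ (x * k + b, x' * k + b') else 0)"
        using * by simp
      also have "\<dots> = (\<Sum>x<d ^ n. \<Sum>x'<d ^ n. if z = r x then if marg_match d n j a a' x x' then M $$ (x * k + b, x' * k + b') else 0 else 0)"
        unfolding eqv by (intro sum.cong refl) simp
      finally show ?thesis .
    qed
    then have "(\<Sum>z\<in>Z. (adj (L z) * M * L z) $$ (a * k + b, a' * k + b')) =
        (\<Sum>z\<in>Z. \<Sum>x<d ^ n. \<Sum>x'<d ^ n. if z = r x then if marg_match d n j a a' x x' then M $$ (x * k + b, x' * k + b') else 0 else 0)"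
      by (intro sum.cong refl)
    also have "\<dots> = (\<Sum>x<d ^ n. \<Sum>z\<in>Z. \<Sum>x'<d ^ n. if z = r x then if marg_match d n j a a' x x' then M $$ (x * k + b, x' * k + b') else 0 else 0)"
      by (rule sum.swap)
    also have "\<dots> = (\<Sum>x<d ^ n. \<Sum>z\<in>Z. if z = r x then \<Sum>x'<d ^ n. if marg_match d n j a a' x x' then M $$ (x * k + b, x' * k + b') else 0 else 0)"
      by (intro sum.cong refl) simp
    also have "\<dots> = marg d n k j M $$ (a * k + b, a' * k + b')"
      using * Z rZ by (simp add: marg_index)
    finally show "marg d n k j M $$ (a * k + b, a' * k + b') =
        mat (d * k) (d * k) (\<lambda>(i, i'). of_real 1 * (\<Sum>z\<in>Z. (adj (L z) * M * L z) $$ (i, i'))) $$ (a * k + b, a' * k + b')"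
      using * by (simp add: pair_index_less)
  qed auto
  moreover have "psd (mat (d * k) (d * k) (\<lambda>(i, i'). of_real 1 * (\<Sum>z\<in>Z. (adj (L z) * M * L z) $$ (i, i'))))"
    using L M by (intro psd_nonneg_sum psd_congruence[OF M L]) (auto intro!: mult_carrier_mat)
  ultimately show ?thesis by simp
qed

lemma kron_one_Wperm_index:
  assumes "0 < d" "\<pi> permutes {..<n}" "a < d" "x < d ^ n" "l < d * d ^ n"
  shows "kron (1\<^sub>m d) (Wperm d n \<pi>) $$ (a * d ^ n + x, l) = (if l = a * d ^ n + permute_digits d n \<pi> x then 1 else 0)"
proof -
  obtain c y where l: "c < d" "y < d ^ n" "l = c * d ^ n + y" using assms(5) by (rule pair_index_cases)
  have pl: "permute_digits d n \<pi> x < d ^ n" using assms by (simp add: permute_digits_less)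
  have "c * d ^ n + y = a * d ^ n + permute_digits d n \<pi> x \<longleftrightarrow> c = a \<and> y = permute_digits d n \<pi> x"
    using pair_index_div_mod[OF l(2), of c] pair_index_div_mod[OF pl, of a] by metis
  moreover have "Wperm d n \<pi> \<in> carrier_mat (d ^ n) (d ^ n)" by (simp add: Wperm_def)
  ultimately show ?thesis using assms l by (auto simp: kron_def pair_index_less Wperm_index)
qed

lemma kron_one_Wperm_carrier: "kron (1\<^sub>m d) (Wperm d n \<pi>) \<in> carrier_mat (d * d ^ n) (d * d ^ n)"
  by (simp add: kron_def Wperm_def carrier_matI)

text \<open>Conjugation by a permutation matrix reindexes rows and columns, so \<open>twirl\<close>
  becomes an average of relabelled copies of \<open>J\<close>. The adjoint is taken twice to bring
  the product into the form of \<open>sandwich_index\<close>.\<close>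

lemma kron_one_Wperm_sandwich_index:
  assumes "0 < d" "\<pi> permutes {..<n}" and J: "J \<in> carrier_mat (d * d ^ n) (d * d ^ n)"
    and "a < d" "x < d ^ n" "a' < d" "x' < d ^ n"
  shows "(kron (1\<^sub>m d) (Wperm d n \<pi>) * J * adj (kron (1\<^sub>m d) (Wperm d n \<pi>))) $$ (a * d ^ n + x, a' * d ^ n + x') =
    J $$ (a * d ^ n + permute_digits d n \<pi> x, a' * d ^ n + permute_digits d n \<pi> x')"
proof -
  let ?V = "kron (1\<^sub>m d) (Wperm d n \<pi>)"
  have V: "?V \<in> carrier_mat (d * d ^ n) (d * d ^ n)" by (rule kron_one_Wperm_carrier)
  have i: "a * d ^ n + x < d * d ^ n" "a' * d ^ n + x' < d * d ^ n" using assms by (auto intro: pair_index_less)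
  have col: "adj ?V $$ (l, b * d ^ n + y) = (if l = b * d ^ n + permute_digits d n \<pi> y then 1 else 0)"
    if "l < d * d ^ n" "b < d" "y < d ^ n" for l b y
    using that V pair_index_less[OF that(2,3)] assms by (simp add: kron_one_Wperm_index)
  have "(adj (adj ?V) * J * adj ?V) $$ (a * d ^ n + x, a' * d ^ n + x') =
      sform (d * d ^ n) J (\<lambda>l. adj ?V $$ (l, a * d ^ n + x)) (\<lambda>l. adj ?V $$ (l, a' * d ^ n + x'))"
    by (rule sandwich_index[OF J adj_carrier[OF V] adj_carrier[OF V] i])
  also have "\<dots> = sform (d * d ^ n) J (\<lambda>l. if l = a * d ^ n + permute_digits d n \<pi> x then 1 else 0)
      (\<lambda>l. if l = a' * d ^ n + permute_digits d n \<pi> x' then 1 else 0)"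
    unfolding sform_def using assms by (intro sum.cong refl) (simp add: col)
  also have "\<dots> = J $$ (a * d ^ n + permute_digits d n \<pi> x, a' * d ^ n + permute_digits d n \<pi> x')"
    using assms by (intro sform_delta pair_index_less permute_digits_less) auto
  finally show ?thesis by simp
qed

lemma twirl_carrier [simp]: "twirl d n J \<in> carrier_mat (d * d ^ n) (d * d ^ n)"
  by (simp add: twirl_def)

lemma twirl_index:
  assumes "0 < d" "J \<in> carrier_mat (d * d ^ n) (d * d ^ n)" "a < d" "x < d ^ n" "a' < d" "x' < d ^ n"
  shows "twirl d n J $$ (a * d ^ n + x, a' * d ^ n + x') =
    (1 / of_nat (fact n)) * (\<Sum>\<pi>\<in>{\<pi>. \<pi> permutes {..<n}}.
      J $$ (a * d ^ n + permute_digits d n \<pi> x, a' * d ^ n + permute_digits d n \<pi> x'))"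
  using assms by (simp add: twirl_def pair_index_less kron_one_Wperm_sandwich_index del: index_mult_mat(1))

lemma psd_twirl:
  assumes J: "J \<in> carrier_mat (d * d ^ n) (d * d ^ n)" "psd J"
  shows "psd (twirl d n J)"
proof -
  have "psd (mat (d * d ^ n) (d * d ^ n) (\<lambda>(i, j). of_real (1 / fact n) * (\<Sum>\<pi>\<in>{\<pi>. \<pi> permutes {..<n}}.
      (kron (1\<^sub>m d) (Wperm d n \<pi>) * J * adj (kron (1\<^sub>m d) (Wperm d n \<pi>))) $$ (i, j))))"
  proof (rule psd_nonneg_sum)
    fix \<pi>
    let ?V = "kron (1\<^sub>m d) (Wperm d n \<pi>)"
    show "?V * J * adj ?V \<in> carrier_mat (d * d ^ n) (d * d ^ n)"
      using J kron_one_Wperm_carrier[of d n \<pi>] by simp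
    show "psd (?V * J * adj ?V)"
      using psd_congruence[OF J adj_carrier[OF kron_one_Wperm_carrier]] by simp
  qed simp
  then show ?thesis by (simp add: twirl_def)
qed

lemma ptrace_second_twirl:
  assumes d: "0 < d" and J: "J \<in> carrier_mat (d * d ^ n) (d * d ^ n)" and tp: "ptrace_second d (d ^ n) J = 1\<^sub>m d"
  shows "ptrace_second d (d ^ n) (twirl d n J) = 1\<^sub>m d"
proof (rule eq_matI)
  fix a a' assume "a < dim_row (1\<^sub>m d :: complex mat)" "a' < dim_col (1\<^sub>m d :: complex mat)"
  then have a: "a < d" "a' < d" by auto
  let ?S = "{\<pi>. \<pi> permutes {..<n}}" and ?N = "d ^ n"
  have "(\<Sum>x<?N. twirl d n J $$ (a * ?N + x, a' * ?N + x)) =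
      (1 / of_nat (fact n)) * (\<Sum>x<?N. \<Sum>\<pi>\<in>?S. J $$ (a * ?N + permute_digits d n \<pi> x, a' * ?N + permute_digits d n \<pi> x))"
    using d a J by (simp add: twirl_index sum_distrib_left)
  also have "\<dots> = (1 / of_nat (fact n)) * (\<Sum>\<pi>\<in>?S. \<Sum>x<?N. J $$ (a * ?N + permute_digits d n \<pi> x, a' * ?N + permute_digits d n \<pi> x))"
    by (subst sum.swap) (rule refl)
  also have "\<dots> = (1 / of_nat (fact n)) * (\<Sum>\<pi>\<in>?S. \<Sum>x<?N. J $$ (a * ?N + x, a' * ?N + x))"
    using sum_permute_digits[OF d, where f = "\<lambda>x. J $$ (a * ?N + x, a' * ?N + x)"] by simp
  also have "(\<Sum>x<?N. J $$ (a * ?N + x, a' * ?N + x)) = 1\<^sub>m d $$ (a, a')"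
    using arg_cong[OF tp, of "\<lambda>A. A $$ (a, a')"] a by (simp add: ptrace_second_def)
  finally show "ptrace_second d (d ^ n) (twirl d n J) $$ (a, a') = 1\<^sub>m d $$ (a, a')"
    using a by (simp add: ptrace_second_def card_permutations)
qed (auto simp: ptrace_second_def)

text \<open>By this idempotence a twirled Choi matrix meets the invariance constraint. Relabelling
  by \<open>\<sigma>\<close> first only shifts the inner sum over the group.\<close>

lemma twirl_twirl:
  assumes d: "0 < d" and J: "J \<in> carrier_mat (d * d ^ n) (d * d ^ n)"
  shows "twirl d n (twirl d n J) = twirl d n J"
proof (rule eq_mat_pairI)
  let ?S = "{\<pi>. \<pi> permutes {..<n}}" and ?N = "d ^ n"
  fix a x a' x' assume *: "a < d" "x < ?N" "a' < d" "x' < ?N"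
  define G where "G \<pi> = J $$ (a * ?N + permute_digits d n \<pi> x, a' * ?N + permute_digits d n \<pi> x')" for \<pi>
  have "twirl d n J $$ (a * ?N + permute_digits d n \<sigma> x, a' * ?N + permute_digits d n \<sigma> x') =
      (1 / of_nat (fact n)) * (\<Sum>\<pi>\<in>?S. G \<pi>)" if "\<sigma> \<in> ?S" for \<sigma>
  proof -
    have "(\<Sum>\<pi>\<in>?S. J $$ (a * ?N + permute_digits d n \<pi> (permute_digits d n \<sigma> x), a' * ?N + permute_digits d n \<pi> (permute_digits d n \<sigma> x')))
        = (\<Sum>\<pi>\<in>?S. G (\<sigma> \<circ> \<pi>))"
      unfolding G_def using d by (intro sum.cong refl) (simp add: permute_digits_compose)
    also have "\<dots> = (\<Sum>\<pi>\<in>?S. G \<pi>)"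
      using that by (intro setum_permutations_compose_left[symmetric]) simp
    finally show ?thesis using * d J by (simp add: twirl_index permute_digits_less)
  qed
  then have "twirl d n (twirl d n J) $$ (a * ?N + x, a' * ?N + x') =
      (1 / of_nat (fact n)) * (\<Sum>\<sigma>\<in>?S. (1 / of_nat (fact n)) * (\<Sum>\<pi>\<in>?S. G \<pi>))"
    using * d by (simp add: twirl_index)
  also have "\<dots> = twirl d n J $$ (a * ?N + x, a' * ?N + x')"
    using * d J by (simp add: twirl_index card_permutations G_def)
  finally show "twirl d n (twirl d n J) $$ (a * ?N + x, a' * ?N + x') = twirl d n J $$ (a * ?N + x, a' * ?N + x')" .
qed auto

text \<open>Digit \<open>p\<close> of the permuted index is digit \<open>\<pi> p\<close> of the
  original, so the digit kept at \<open>j\<close> is found at the inverse image of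
  \<open>j\<close>.\<close>

lemma marg_match_permute:
  assumes d: "0 < d" and \<pi>: "\<pi> permutes {..<n}" and j: "j < n"
  shows "marg_match d n (Hilbert_Choice.inv \<pi> j) a a' (permute_digits d n \<pi> x) (permute_digits d n \<pi> x') \<longleftrightarrow>
    marg_match d n j a a' x x'"
proof -
  have i: "Hilbert_Choice.inv \<pi> p < n" if "p < n" for p
    using permutes_in_image[OF permutes_inv[OF \<pi>], of p] that by simp
  have "dig d n (permute_digits d n \<pi> y) (Hilbert_Choice.inv \<pi> p) = dig d n y p" if "p < n" for p y
    using that by (simp only: dig_permute_digits[OF d i] permutes_inverses[OF \<pi>])
  note e = this
  have "(\<forall>p<n. p \<noteq> Hilbert_Choice.inv \<pi> j \<longrightarrow> dig d n (permute_digits d n \<pi> x) p = dig d n (permute_digits d n \<pi> x') p)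
      \<longleftrightarrow> (\<forall>p<n. p \<noteq> j \<longrightarrow> dig d n x p = dig d n x' p)" (is "?l \<longleftrightarrow> ?r")
  proof
    assume l: ?l
    show ?r
    proof (intro allI impI)
      fix p assume p: "p < n" "p \<noteq> j"
      then have "Hilbert_Choice.inv \<pi> p \<noteq> Hilbert_Choice.inv \<pi> j" using permutes_inverses(1)[OF \<pi>] by metis
      then show "dig d n x p = dig d n x' p" using l i[OF p(1)] e[OF p(1)] by metis
    qed
  next
    assume r: ?r
    show ?l
    proof (intro allI impI)
      fix p assume p: "p < n" "p \<noteq> Hilbert_Choice.inv \<pi> j"
      have "\<pi> p < n" using permutes_in_image[OF \<pi>, of p] p by simp
      moreover have "\<pi> p \<noteq> j" using p(2) permutes_inverses(2)[OF \<pi>] by metis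
      ultimately show "dig d n (permute_digits d n \<pi> x) p = dig d n (permute_digits d n \<pi> x') p"
        unfolding dig_permute_digits[OF d p(1)] using r by blast
    qed
  qed
  then show ?thesis unfolding marg_match_def e[OF j] by simp
qed

text \<open>Each relabelled copy of \<open>J\<close> has the old marginals at moved positions. The
  average is left as a sum over permutations, so that the averaged X can be defined by the same
  formula.\<close>

lemma marg_choi_out_twirl:
  assumes d: "0 < d" and J: "J \<in> carrier_mat (d * d ^ n) (d * d ^ n)" and j: "j < n"
  shows "marg d n k j (choi_out d (d ^ n) k (twirl d n J) M) = mat (d * k) (d * k) (\<lambda>(i, i').
    of_real (1 / fact n) * (\<Sum>\<pi>\<in>{\<pi>. \<pi> permutes {..<n}}. marg d n k (\<pi> j) (choi_out d (d ^ n) k J M) $$ (i, i')))"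
proof (rule eq_mat_pairI[OF marg_carrier])
  let ?S = "{\<pi>. \<pi> permutes {..<n}}" and ?N = "d ^ n"
  fix a b a' b' assume *: "a < d" "b < k" "a' < d" "b' < k"
  define G where "G x x' = choi_out d ?N k J M $$ (x * k + b, x' * k + b')" for x x'
  define H where "H i x x' = (if marg_match d n i a a' x x' then G x x' else 0)" for i x x'
  define c :: complex where "c = 1 / of_nat (fact n)"
  have co: "choi_out d ?N k (twirl d n J) M $$ (x * k + b, x' * k + b') =
      c * (\<Sum>\<pi>\<in>?S. G (permute_digits d n \<pi> x) (permute_digits d n \<pi> x'))" if "x < ?N" "x' < ?N" for x x'
  proof -
    have "choi_out d ?N k (twirl d n J) M $$ (x * k + b, x' * k + b') =
      (\<Sum>e<d. \<Sum>e'<d. \<Sum>\<pi>\<in>?S. c * (J $$ (e * ?N + permute_digits d n \<pi> x, e' * ?N + permute_digits d n \<pi> x') * M $$ (e * k + b, e' * k + b')))"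
      using that * d J
      by (simp add: choi_out_index twirl_index c_def[symmetric] sum_distrib_left sum_distrib_right mult.assoc
          del: of_nat_fact)
    also have "\<dots> = (\<Sum>e<d. \<Sum>\<pi>\<in>?S. \<Sum>e'<d. c * (J $$ (e * ?N + permute_digits d n \<pi> x, e' * ?N + permute_digits d n \<pi> x') * M $$ (e * k + b, e' * k + b')))"
      by (intro sum.cong refl sum.swap)
    also have "\<dots> = (\<Sum>\<pi>\<in>?S. \<Sum>e<d. \<Sum>e'<d. c * (J $$ (e * ?N + permute_digits d n \<pi> x, e' * ?N + permute_digits d n \<pi> x') * M $$ (e * k + b, e' * k + b')))"
      by (rule sum.swap)
    finally show ?thesis using * d by (simp add: G_def choi_out_index permute_digits_less sum_distrib_left)
  qed
  have "marg d n k j (choi_out d ?N k (twirl d n J) M) $$ (a * k + b, a' * k + b') =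
      (\<Sum>x<?N. \<Sum>x'<?N. \<Sum>\<pi>\<in>?S. c * H (Hilbert_Choice.inv \<pi> j) (permute_digits d n \<pi> x) (permute_digits d n \<pi> x'))"
    unfolding marg_index[OF *]
  proof (intro sum.cong refl)
    fix x x' assume "x \<in> {..<?N}" "x' \<in> {..<?N}"
    then have "x < ?N" "x' < ?N" by auto
    then show "(if marg_match d n j a a' x x' then choi_out d ?N k (twirl d n J) M $$ (x * k + b, x' * k + b') else 0) =
        (\<Sum>\<pi>\<in>?S. c * H (Hilbert_Choice.inv \<pi> j) (permute_digits d n \<pi> x) (permute_digits d n \<pi> x'))"
      by (simp add: H_def marg_match_permute[OF d _ j] co sum_distrib_left)
  qed
  also have "\<dots> = (\<Sum>x<?N. \<Sum>\<pi>\<in>?S. \<Sum>x'<?N. c * H (Hilbert_Choice.inv \<pi> j) (permute_digits d n \<pi> x) (permute_digits d n \<pi> x'))"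
    by (intro sum.cong refl sum.swap)
  also have "\<dots> = (\<Sum>\<pi>\<in>?S. \<Sum>x<?N. \<Sum>x'<?N. c * H (Hilbert_Choice.inv \<pi> j) (permute_digits d n \<pi> x) (permute_digits d n \<pi> x'))"
    by (rule sum.swap)
  \<comment> \<open>Both index sums run over everything, so the relabelling of digits disappears and
    only the moved position remains.\<close>
  also have "\<dots> = (\<Sum>\<pi>\<in>?S. \<Sum>x<?N. \<Sum>x'<?N. c * H (Hilbert_Choice.inv \<pi> j) x x')"
  proof (rule sum.cong[OF refl])
    fix \<pi> assume "\<pi> \<in> ?S"
    then have \<pi>: "\<pi> permutes {..<n}" by simp
    have "(\<Sum>x<?N. \<Sum>x'<?N. c * H (Hilbert_Choice.inv \<pi> j) (permute_digits d n \<pi> x) (permute_digits d n \<pi> x')) =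
        (\<Sum>x<?N. \<Sum>x'<?N. c * H (Hilbert_Choice.inv \<pi> j) (permute_digits d n \<pi> x) x')"
      by (intro sum.cong[OF refl] sum_permute_digits[OF d \<pi>])
    also have "\<dots> = (\<Sum>x<?N. \<Sum>x'<?N. c * H (Hilbert_Choice.inv \<pi> j) x x')"
      by (rule sum_permute_digits[OF d \<pi>, where f = "\<lambda>x. \<Sum>x'<?N. c * H (Hilbert_Choice.inv \<pi> j) x x'"])
    finally show "(\<Sum>x<?N. \<Sum>x'<?N. c * H (Hilbert_Choice.inv \<pi> j) (permute_digits d n \<pi> x) (permute_digits d n \<pi> x')) =
        (\<Sum>x<?N. \<Sum>x'<?N. c * H (Hilbert_Choice.inv \<pi> j) x x')" .
  qed
  also have "\<dots> = (\<Sum>\<pi>\<in>?S. c * marg d n k (Hilbert_Choice.inv \<pi> j) (choi_out d ?N k J M) $$ (a * k + b, a' * k + b'))"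
    unfolding marg_index[OF *] by (simp add: H_def G_def sum_distrib_left cong: if_cong)
  \<comment> \<open>Inversion permutes the group, which removes the inverse.\<close>
  also have "\<dots> = (\<Sum>\<pi>\<in>?S. c * marg d n k (\<pi> j) (choi_out d ?N k J M) $$ (a * k + b, a' * k + b'))"
    by (rule sum_permutations_inverse[symmetric])
  finally show "marg d n k j (choi_out d ?N k (twirl d n J) M) $$ (a * k + b, a' * k + b') =
      mat (d * k) (d * k) (\<lambda>(i, i'). of_real (1 / fact n) * (\<Sum>\<pi>\<in>?S. marg d n k (\<pi> j) (choi_out d ?N k J M) $$ (i, i')))
        $$ (a * k + b, a' * k + b')"
    using * by (simp add: pair_index_less c_def sum_distrib_left)
qed simp

section \<open>Comparison of the two optimal values\<close>

lemma Sup_eq_if_mutually_dominated: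
  fixes A B :: "real set"
  assumes "\<And>a. a \<in> A \<Longrightarrow> \<exists>b\<in>B. a \<le> b" "\<And>b. b \<in> B \<Longrightarrow> \<exists>a\<in>A. b \<le> a"
  shows "Sup A = Sup B"
proof -
  \<comment> \<open>A real \<open>Sup\<close> is by definition the least upper bound, so it is
    determined by the set of upper bounds, and mutual domination makes these sets equal.\<close>
  have "(\<forall>x\<in>A. x \<le> z) \<longleftrightarrow> (\<forall>x\<in>B. x \<le> z)" for z
    using assms by (meson order_trans)
  then show ?thesis by (simp add: Sup_real_def)
qed

lemma half_mtrace_add_adj:
  assumes "X \<in> carrier_mat n n"
  shows "(1 / 2) * Re (mtrace (X + adj X)) = Re (mtrace X)"
  using assms by (simp add: mtrace_def sum.distrib flip: sum_distrib_left)

text \<open>The twirl only sees the average over the output positions, whichever position is kept.\<close>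
lemma marg_choi_out_twirl_independent:
  assumes d: "0 < d" and J: "J \<in> carrier_mat (d * d ^ n) (d * d ^ n)" and j: "j < n" "j' < n"
  shows "marg d n k j (choi_out d (d ^ n) k (twirl d n J) M) = marg d n k j' (choi_out d (d ^ n) k (twirl d n J) M)"
proof -
  have eq: "(\<Sum>\<pi>\<in>{\<pi>. \<pi> permutes {..<n}}. g (\<pi> j)) = (\<Sum>\<pi>\<in>{\<pi>. \<pi> permutes {..<n}}. g (\<pi> j'))" for g :: "nat \<Rightarrow> complex"
  proof -
    have "of_nat n * (\<Sum>\<pi>\<in>{\<pi>. \<pi> permutes {..<n}}. g (\<pi> j)) = of_nat n * (\<Sum>\<pi>\<in>{\<pi>. \<pi> permutes {..<n}}. g (\<pi> j'))"
      using sum_permutes_apply[OF j(1), of g] sum_permutes_apply[OF j(2), of g] by simp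
    then show ?thesis using j by simp
  qed
  show ?thesis
    unfolding marg_choi_out_twirl[OF d J j(1)] marg_choi_out_twirl[OF d J j(2)]
    by (intro eq_matI) (auto simp: eq[of "\<lambda>l. marg d n k l (choi_out d (d ^ n) k J M) $$ (i, i')" for i i'])
qed

text \<open>The optimal block matrices of the n marginals all have \<open>\<rho>\<close> in the
  upper corner. Averaged over permutations they stay positive, and their lower corner is the reduced
  operator of the twirled Choi matrix.\<close>

lemma sdp_feasible_from_channel:
  assumes dA: "0 < dA" and n: "0 < n" and \<rho>: "\<rho> \<in> carrier_mat (dA * dB) (dA * dB)" "psd \<rho>"
    and \<Lambda>: "quantum_channel dA (dA ^ n) \<Lambda>"
  obtains X J where "sdp_feasible dA dB n \<rho> X J"
    "Re (mtrace X) = (1 / real n) * (\<Sum>j<n. fidelity \<rho> (marg dA n dB j (chan_tensor_id \<Lambda> dA (dA ^ n) dB \<rho>)))"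
proof -
  let ?S = "{\<pi>. \<pi> permutes {..<n}}" and ?N = "dA ^ n" and ?D = "dA * dB"
  define J where "J = choi dA ?N \<Lambda>"
  define J' where "J' = twirl dA n J"
  define \<sigma> where "\<sigma> j = marg dA n dB j (chan_tensor_id \<Lambda> dA ?N dB \<rho>)" for j
  have J: "J \<in> carrier_mat (dA * ?N) (dA * ?N)" "psd J" "ptrace_second dA ?N J = 1\<^sub>m dA"
    using psd_choi[OF \<Lambda>] ptrace_second_choi[OF \<Lambda>] by (simp_all add: J_def)
  have J': "J' \<in> carrier_mat (dA * ?N) (dA * ?N)" "psd J'" "ptrace_second dA ?N J' = 1\<^sub>m dA" "twirl dA n J' = J'"
    using psd_twirl[OF J(1,2)] ptrace_second_twirl[OF dA J(1,3)] twirl_twirl[OF dA J(1)]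
    by (simp_all add: J'_def)
  have \<sigma>_eq: "\<sigma> j = marg dA n dB j (choi_out dA ?N dB J \<rho>)" for j
    by (simp add: \<sigma>_def J_def chan_tensor_id_choi[OF \<Lambda>])
  have \<sigma>c: "\<sigma> j \<in> carrier_mat ?D ?D" for j by (simp add: \<sigma>_def)
  \<comment> \<open>Guarding only the optimality by \<open>j < n\<close> gives a choice function
    whose values have the right dimension at every \<open>j\<close>; the zero matrix serves outside
    the range.\<close>
  have "\<exists>X. X \<in> carrier_mat ?D ?D \<and> (j < n \<longrightarrow> psd (four_block_mat \<rho> X (adj X) (\<sigma> j)) \<and> Re (mtrace X) = fidelity \<rho> (\<sigma> j))" for j
  proof (cases "j < n")
    case True
    have "psd (\<sigma> j)" unfolding \<sigma>_eq by (rule psd_marg[OF _ psd_choi_out[OF J(1,2) \<rho>] True dA]) simp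
    from fidelity_attained[OF \<rho> \<sigma>c this] show ?thesis by metis
  qed (auto intro!: exI[of _ "0\<^sub>m ?D ?D"])
  then obtain Y where Y: "\<And>j. Y j \<in> carrier_mat ?D ?D"
    "\<And>j. j < n \<Longrightarrow> psd (four_block_mat \<rho> (Y j) (adj (Y j)) (\<sigma> j))"
    "\<And>j. j < n \<Longrightarrow> Re (mtrace (Y j)) = fidelity \<rho> (\<sigma> j)"
    by metis
  \<comment> \<open>The average runs over permutations, in parallel with \<open>red\<close>;
    \<open>sum_permutes_apply\<close> converts it to the mean over positions when the trace is
    computed.\<close>
  define X where "X = mat ?D ?D (\<lambda>(i, i'). of_real (1 / fact n) * (\<Sum>\<pi>\<in>?S. Y (\<pi> 0) $$ (i, i')))"
  have red: "reduced_op dA dB n J' \<rho> = mat ?D ?D (\<lambda>(i, i'). of_real (1 / fact n) * (\<Sum>\<pi>\<in>?S. \<sigma> (\<pi> 0) $$ (i, i')))"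
    unfolding reduced_op_choi_out[OF J'(1) \<rho>(1)] unfolding J'_def marg_choi_out_twirl[OF dA J(1) n] \<sigma>_eq ..
  have \<pi>0: "\<pi> 0 < n" if "\<pi> \<in> ?S" for \<pi>
    using that n permutes_in_image[of \<pi> "{..<n}" 0] by simp
  let ?B = "\<lambda>j. four_block_mat \<rho> (Y j) (adj (Y j)) (\<sigma> j)"
  have B: "?B j \<in> carrier_mat (?D + ?D) (?D + ?D)" for j using \<rho> \<sigma>c by simp
  have "four_block_mat \<rho> X (adj X) (reduced_op dA dB n J' \<rho>) =
      mat (?D + ?D) (?D + ?D) (\<lambda>(i, j). of_real (1 / fact n) * (\<Sum>\<pi>\<in>?S. ?B (\<pi> 0) $$ (i, j)))" (is "?L = ?R")
  proof (rule eq_matI)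
    fix i j assume "i < dim_row ?R" "j < dim_col ?R"
    then have ij: "i < ?D + ?D" "j < ?D + ?D" by auto
    have dims: "dim_row \<rho> = ?D" "dim_col \<rho> = ?D" "\<And>j. dim_row (\<sigma> j) = ?D" "\<And>j. dim_col (\<sigma> j) = ?D"
      "\<And>j. dim_row (Y j) = ?D" "\<And>j. dim_col (Y j) = ?D"
      using \<rho> \<sigma>c Y(1) by auto
    have "?L $$ (i, j) = (if i < ?D then if j < ?D then \<rho> $$ (i, j) else X $$ (i, j - ?D)
        else if j < ?D then adj X $$ (i - ?D, j) else reduced_op dA dB n J' \<rho> $$ (i - ?D, j - ?D))"
      using ij by (simp add: red dims)
    also have "\<dots> = of_real (1 / fact n) * (\<Sum>\<pi>\<in>?S. if i < ?D then if j < ?D then \<rho> $$ (i, j) else Y (\<pi> 0) $$ (i, j - ?D)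
        else if j < ?D then adj (Y (\<pi> 0)) $$ (i - ?D, j) else \<sigma> (\<pi> 0) $$ (i - ?D, j - ?D))"
      using ij by (auto simp: red X_def dims card_permutations)
    also have "\<dots> = ?R $$ (i, j)" using ij by (simp add: dims cong: if_cong)
    finally show "?L $$ (i, j) = ?R $$ (i, j)" .
  qed (use \<rho> in \<open>auto simp: red\<close>)
  moreover have "psd ?R" using B Y(2) \<pi>0 by (intro psd_nonneg_sum) auto
  ultimately have "psd (four_block_mat \<rho> X (adj X) (reduced_op dA dB n J' \<rho>))" by simp
  then have "sdp_feasible dA dB n \<rho> X J'"
    using J' by (simp add: sdp_feasible_def X_def psd_def[of J'])
  moreover have "Re (mtrace X) = (1 / real n) * (\<Sum>j<n. fidelity \<rho> (\<sigma> j))"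
  proof -
    have "mtrace X = (\<Sum>i<?D. of_real (1 / fact n) * (\<Sum>\<pi>\<in>?S. Y (\<pi> 0) $$ (i, i)))"
      by (simp add: mtrace_def X_def)
    also have "\<dots> = of_real (1 / fact n) * (\<Sum>\<pi>\<in>?S. \<Sum>i<?D. Y (\<pi> 0) $$ (i, i))"
      by (subst sum.swap) (simp add: sum_distrib_left)
    also have "\<dots> = of_real (1 / fact n) * (\<Sum>\<pi>\<in>?S. mtrace (Y (\<pi> 0)))"
      using Y(1) by (simp add: mtrace_def carrier_matD(1)[OF Y(1)])
    finally have "Re (mtrace X) = (1 / fact n) * Re (\<Sum>\<pi>\<in>?S. mtrace (Y (\<pi> 0)))"
      by (simp only: scaleR_conv_of_real[symmetric] scaleR_complex.sel)
    then have "Re (mtrace X) = (1 / fact n) * (\<Sum>\<pi>\<in>?S. fidelity \<rho> (\<sigma> (\<pi> 0)))"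
      using \<pi>0 Y(3) by simp
    then have "real n * fact n * Re (mtrace X) = of_nat n * (\<Sum>\<pi>\<in>?S. fidelity \<rho> (\<sigma> (\<pi> 0)))" by simp
    also have "\<dots> = fact n * (\<Sum>j<n. fidelity \<rho> (\<sigma> j))"
      by (subst sum_permutes_apply[OF n]) simp
    finally show ?thesis using n by (simp add: field_simps)
  qed
  ultimately show thesis using that unfolding \<sigma>_def by blast
qed

lemma sdp_feasible_bounded_by_channel:
  assumes dA: "0 < dA" and n: "0 < n" and \<rho>: "\<rho> \<in> carrier_mat (dA * dB) (dA * dB)" "psd \<rho>"
    and feas: "sdp_feasible dA dB n \<rho> X J"
  obtains \<Lambda> where "quantum_channel dA (dA ^ n) \<Lambda>"
    "Re (mtrace X) \<le> (1 / real n) * (\<Sum>j<n. fidelity \<rho> (marg dA n dB j (chan_tensor_id \<Lambda> dA (dA ^ n) dB \<rho>)))"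
proof -
  let ?N = "dA ^ n"
  have X: "X \<in> carrier_mat (dA * dB) (dA * dB)" and J: "J \<in> carrier_mat (dA * ?N) (dA * ?N)" "psd J"
    and tp: "ptrace_second dA ?N J = 1\<^sub>m dA" and tw: "twirl dA n J = J"
    and blk: "psd (four_block_mat \<rho> X (adj X) (reduced_op dA dB n J \<rho>))"
    using feas by (auto simp: sdp_feasible_def)
  define \<Lambda> where "\<Lambda> = choi_out dA ?N 1 J"
  define \<sigma> where "\<sigma> = marg dA n dB 0 (choi_out dA ?N dB J \<rho>)"
  \<comment> \<open>\<open>J\<close> is its own twirl, so the independence of the kept position
    applies to \<open>J\<close> itself, and the mean of the fidelities collapses to a single
    one.\<close>
  have "marg dA n dB j (chan_tensor_id \<Lambda> dA ?N dB \<rho>) = \<sigma>" if "j < n" for j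
    using marg_choi_out_twirl_independent[OF dA J(1) that n, of dB \<rho>]
    unfolding \<Lambda>_def chan_tensor_id_choi_out tw \<sigma>_def .
  then have "(1 / real n) * (\<Sum>j<n. fidelity \<rho> (marg dA n dB j (chan_tensor_id \<Lambda> dA ?N dB \<rho>))) = fidelity \<rho> \<sigma>"
    using n by simp
  moreover have "Re (mtrace X) \<le> fidelity \<rho> \<sigma>"
  proof (rule fidelity_upper_bound[OF \<rho> _ _ X])
    show "psd \<sigma>" unfolding \<sigma>_def by (rule psd_marg[OF _ psd_choi_out[OF J \<rho>] n dA]) simp
    show "psd (four_block_mat \<rho> X (adj X) \<sigma>)"
      using blk unfolding reduced_op_choi_out[OF J(1) \<rho>(1)] \<sigma>_def .
  qed (simp add: \<sigma>_def)
  moreover have "quantum_channel dA ?N \<Lambda>" unfolding \<Lambda>_def by (rule quantum_channel_choi_out[OF J tp])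
  ultimately show thesis using that by metis
qed

theorem theorem2:
  fixes dA dB n :: nat and \<rho> :: "complex mat"
  assumes "dA \<ge> 1" and "dB \<ge> 1" and "n \<ge> 1"
    and "density (dA * dB) \<rho>"
  shows "unilocal_fid dA dB n \<rho> = sdp_value dA dB n \<rho>"
proof -
  have pos: "0 < dA" "0 < n" and \<rho>: "\<rho> \<in> carrier_mat (dA * dB) (dA * dB)" "psd \<rho>"
    using assms by (auto simp: density_def)
  have half: "(1 / 2) * Re (mtrace (X + adj X)) = Re (mtrace X)" if "sdp_feasible dA dB n \<rho> X J" for X J
    using that by (intro half_mtrace_add_adj) (auto simp: sdp_feasible_def)
  show ?thesis
    unfolding unilocal_fid_def sdp_value_def
  proof (rule Sup_eq_if_mutually_dominated, goal_cases)
    case (1 v)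
    then obtain \<Lambda> where \<Lambda>: "quantum_channel dA (dA ^ n) \<Lambda>"
      and v: "v = (1 / real n) * (\<Sum>j<n. fidelity \<rho> (marg dA n dB j (chan_tensor_id \<Lambda> dA (dA ^ n) dB \<rho>)))"
      by blast
    obtain X J where "sdp_feasible dA dB n \<rho> X J" "Re (mtrace X) = v"
      using sdp_feasible_from_channel[OF pos \<rho> \<Lambda>] unfolding v by blast
    then have "v = (1 / 2) * Re (mtrace (X + adj X))" using half by simp
    with \<open>sdp_feasible dA dB n \<rho> X J\<close> show ?case by blast
  next
    case (2 v)
    then obtain X J where f: "sdp_feasible dA dB n \<rho> X J" and v: "v = Re (mtrace X)"
      using half by auto
    obtain \<Lambda> where "quantum_channel dA (dA ^ n) \<Lambda>"
      "v \<le> (1 / real n) * (\<Sum>j<n. fidelity \<rho> (marg dA n dB j (chan_tensor_id \<Lambda> dA (dA ^ n) dB \<rho>)))"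
      using sdp_feasible_bounded_by_channel[OF pos \<rho> f] unfolding v by blast
    then show ?case by blast
  qed
qed

end
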